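(* Let $r_0>0$, $v_\infty\in\mathbb{R}$, $\mathbf{v}_\infty=(v_\infty,0)$. Let the Fourier coefficients $w_k(r)$, $k\in\mathbb{Z}$, of $w(\mathbf{x})$ satisfy $$w_k(s)\sqrt s\in L_1(r_0,\infty)\ \ (k\in\mathbb{Z}\setminus\{0\}),\qquad w_0(s)\,s\in L_1(r_0,\infty),$$ and $$\int_{r_0}^\infty s^{-|k|+1}w_k(s)\,ds=\frac{i\,v_\infty\,\delta_{|k|,1}\operatorname{sign}(k)}{r_0^{|k|-1}},\qquad k\in\mathbb{Z}.$$ Then there exists a unique solution $\mathbf{v}(\mathbf{x})$ of the system $$\operatorname{div}\mathbf{v}=0,\quad \operatorname{curl}\mathbf{v}=w \ \text{ in } |\mathbf{x}|>r_0,\qquad \mathbf{v}(\mathbf{x})=0 \text{ for } |\mathbf{x}|=r_0,\qquad \mathbf{v}(\mathbf{x})\to\mathbf{v}_\infty \text{ as } |\mathbf{x}|\to\infty,$$ and it is given by the Fourier coefficients ($k\in\mathbb{Z}$) $$v_{r,k}(r)=\operatorname{sign}(k)\frac{i r^{-|k|-1}}2\int_{r_0}^r s^{|k|+1}w_k(s)\,ds+\operatorname{sign}(k)\frac{i r^{|k|-1}}2\int_r^\infty s^{-|k|+1}w_k(s)\,ds+\frac{\delta_{|k|,1}}2v_\infty,$$ $$v_{\varphi,k}(r)=\frac{r^{-|k|-1}}2\int_{r_0}^r s^{|k|+1}w_k(s)\,ds-\frac{r^{|k|-1}}2\int_r^\infty s^{-|k|+1}w_k(s)\,ds-\operatorname{sign}(k)\frac{\delta_{|k|,1}}{2i}v_\infty,$$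 with $v_{r,k},v_{\varphi,k}\in L_\infty(r_0,\infty)$.
   Context: Here $\operatorname{curl}\mathbf{v}=\partial_{x_1}v_2-\partial_{x_2}v_1$, and $(r,\varphi)$ are polar coordinates. A vector field is written by its radial and tangential components $(v_r,v_\varphi)$, with Fourier expansions $v_r=\sum_k v_{r,k}(r)e^{ik\varphi}$, $v_\varphi=\sum_k v_{\varphi,k}(r)e^{ik\varphi}$; likewise $w=\sum_k w_k(r)e^{ik\varphi}$. The system is understood through Fourier coefficients: the equations $\operatorname{div}\mathbf{v}=0$, $\operatorname{curl}\mathbf{v}=w$ read $$\frac1r\frac{\partial}{\partial r}(rv_{r,k})+\frac{ik}rv_{\varphi,k}=0,\qquad \frac1r\frac{\partial}{\partial r}(rv_{\varphi,k})-\frac{ik}rv_{r,k}=w_k,$$ and the constant field $\mathbf{v}_\infty$ has polar components $v_\infty(\cos\varphi,-\sin\varphi)$. $\delta_{|k|,1}$ is the Kronecker delta, and $\operatorname{sign}(k)=1,0,-1$ for $k>0$, $k=0$, $k<0$ respectively. *)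

theory Defs
  imports "HOL-Analysis.Analysis"
begin

definition fourier_coeff :: "(real \<Rightarrow> complex) \<Rightarrow> int \<Rightarrow> complex" where
  "fourier_coeff f k =
     (1 / (2 * pi)) *\<^sub>R (LINT \<phi>:{0..2*pi}|lebesgue. f \<phi> * cis (- (of_int k * \<phi>)))"

text \<open>Absolute continuity on \<open>[a, b]\<close>; a finite family of non-overlapping compact subintervals
  is expressed as a division of its own union, so that an interval \<open>K\<close> has the endpoints
  \<open>Inf K\<close> and \<open>Sup K\<close>.\<close>

definition absolutely_continuous_on_interval ::
  "real \<Rightarrow> real \<Rightarrow> (real \<Rightarrow> complex) \<Rightarrow> bool" where
  "absolutely_continuous_on_interval a b f \<longleftrightarrow>
     (\<forall>\<epsilon>>0. \<exists>\<delta>>0. \<forall>D. D division_of \<Union>D \<and> \<Union>D \<subseteq> {a..b} \<and> (\<Sum>K\<in>D. Sup K - Inf K) < \<delta>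
        \<longrightarrow> (\<Sum>K\<in>D. norm (f (Sup K) - f (Inf K))) < \<epsilon>)"

definition essentially_bounded_on :: "real set \<Rightarrow> (real \<Rightarrow> complex) \<Rightarrow> bool" where
  "essentially_bounded_on A f \<longleftrightarrow>
     set_borel_measurable lebesgue A f \<and> (\<exists>C. AE r in lebesgue. r \<in> A \<longrightarrow> norm (f r) \<le> C)"

text \<open>A scalar field is given by its family of Fourier coefficients \<open>w k r\<close> in the angle, a vector
  field by the two families \<open>vr k r\<close> and \<open>vphi k r\<close> of its radial and tangential component.
  No convergence of the Fourier series is required: even for smooth \<open>w\<close> the coefficients of the
  solution may grow exponentially in \<open>\<bar>k\<bar>\<close>, so that they belong to no function of \<open>x\<close>.

  As \<open>w k\<close> is merely integrable, the equations hold in the sense of Caratheodory: the coefficients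
  are locally absolutely continuous up to the boundary \<open>r = r0\<close> and the equations hold almost
  everywhere. The values of the coefficients for \<open>r < r0\<close> are irrelevant.\<close>

type_synonym fourier_field = "int \<Rightarrow> real \<Rightarrow> complex"

definition divergence_eq_zero :: "real \<Rightarrow> fourier_field \<Rightarrow> fourier_field \<Rightarrow> bool" where
  "divergence_eq_zero r0 vr vphi \<longleftrightarrow>
     (\<forall>k. AE r in lebesgue. r > r0 \<longrightarrow>
        (\<exists>d. ((\<lambda>s. of_real s * vr k s) has_vector_derivative d) (at r) \<and>
             1 / of_real r * d + \<i> * of_int k / of_real r * vphi k r = 0))"

definition curl_eq ::
  "real \<Rightarrow> fourier_field \<Rightarrow> fourier_field \<Rightarrow> fourier_field \<Rightarrow> bool" where
  "curl_eq r0 vr vphi w \<longleftrightarrow>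
     (\<forall>k. AE r in lebesgue. r > r0 \<longrightarrow>
        (\<exists>d. ((\<lambda>s. of_real s * vphi k s) has_vector_derivative d) (at r) \<and>
             1 / of_real r * d - \<i> * of_int k / of_real r * vr k r = w k r))"

definition div_curl_solution ::
  "real \<Rightarrow> real \<Rightarrow> fourier_field \<Rightarrow> fourier_field \<Rightarrow> fourier_field \<Rightarrow> bool" where
  "div_curl_solution r0 vinf w vr vphi \<longleftrightarrow>
     (\<forall>k R. absolutely_continuous_on_interval r0 R (vr k) \<and>
            absolutely_continuous_on_interval r0 R (vphi k)) \<and>
     divergence_eq_zero r0 vr vphi \<and>
     curl_eq r0 vr vphi w \<and>
     (\<forall>k. vr k r0 = 0 \<and> vphi k r0 = 0) \<and>
     (\<forall>k. (vr k \<longlongrightarrow> fourier_coeff (\<lambda>\<phi>. of_real (vinf * cos \<phi>)) k) at_top \<and>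
          (vphi k \<longlongrightarrow> fourier_coeff (\<lambda>\<phi>. of_real (- vinf * sin \<phi>)) k) at_top)"

definition kronecker_delta :: "int \<Rightarrow> int \<Rightarrow> complex" where
  "kronecker_delta j k = (if j = k then 1 else 0)"

end

theory Submission
  imports Defs
begin

text \<open>With \<open>m = \<bar>k\<bar>\<close>, the \<open>k\<close>-th coefficients are combinations of the inner mode \<open>P\<close> (weight
  \<open>s powi (m + 1)\<close>, integrated from \<open>r0\<close>) and the outer mode \<open>Q\<close> (weight \<open>s powi (- m + 1)\<close>,
  integrated to infinity), which satisfy \<open>(r P)' = r w - m P\<close> and \<open>(r Q)' = m Q - r w\<close>; this is Lebesgue's
  differentiation theorem for the two integrals. The integrability of \<open>w\<close> against \<open>s powr \<alpha>\<close>, with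
  \<open>\<alpha> = 1/2\<close> for \<open>k \<noteq> 0\<close> and \<open>\<alpha> = 1\<close> for \<open>k = 0\<close>, bounds both modes by a multiple of \<open>r powr - \<alpha>\<close>,
  so only the constant field survives at infinity, and the moment conditions are exactly the vanishing
  of the coefficients on \<open>r = r0\<close>. The difference of two solutions solves a homogeneous linear system with
  zero data at \<open>r0\<close>; it vanishes because an absolutely continuous function whose derivative is zero
  almost everywhere is constant.\<close>

section \<open>Absolutely continuous functions\<close>

text \<open>The cells of a division are nonempty compact intervals, so \<open>Inf\<close> and
  \<open>Sup\<close> recover their endpoints; sums over divisions are evaluated cell by cell through
  this.\<close>

lemma subinterval_endpoints:
  fixes a b :: real
  assumes "K \<in> D" "D division_of \<Union>D" "\<Union>D \<subseteq> {a..b}"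
  obtains u v where "K = {u..v}" "u \<le> v" "a \<le> u" "v \<le> b" "Inf K = u" "Sup K = v"
proof -
  obtain u v where K: "K = cbox u v"
    using assms(1,2) by (blast elim: division_ofD)
  moreover have "K \<noteq> {}"
    using assms(1,2) by (blast dest: division_ofD)
  ultimately have "u \<le> v" by auto
  moreover have "K \<subseteq> {a..b}"
    using assms(1,3) by blast
  ultimately show ?thesis
    using that[of u v] K by (auto simp: cbox_interval)
qed

lemma AC_obtain_delta:
  assumes "absolutely_continuous_on_interval a b f" "e > 0"
  obtains d where "d > 0"
    "\<And>D. D division_of \<Union>D \<Longrightarrow> \<Union>D \<subseteq> {a..b} \<Longrightarrow> (\<Sum>K\<in>D. Sup K - Inf K) < d \<Longrightarrow>
      (\<Sum>K\<in>D. norm (f (Sup K) - f (Inf K))) < e"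
proof -
  obtain d where "d > 0" "\<forall>D. D division_of \<Union>D \<and> \<Union>D \<subseteq> {a..b} \<and> (\<Sum>K\<in>D. Sup K - Inf K) < d
      \<longrightarrow> (\<Sum>K\<in>D. norm (f (Sup K) - f (Inf K))) < e"
    using assms unfolding absolutely_continuous_on_interval_def by auto
  then show ?thesis by (intro that[of d]) auto
qed

lemma AC_lipschitz:
  assumes "L-lipschitz_on {a..b} f"
  shows "absolutely_continuous_on_interval a b f"
  unfolding absolutely_continuous_on_interval_def
proof (intro allI impI)
  fix e :: real assume "e > 0"
  have L: "L \<ge> 0" using assms by (rule lipschitz_on_nonneg)
  show "\<exists>\<delta>>0. \<forall>D. D division_of \<Union>D \<and> \<Union>D \<subseteq> {a..b} \<and> (\<Sum>K\<in>D. Sup K - Inf K) < \<delta>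
        \<longrightarrow> (\<Sum>K\<in>D. norm (f (Sup K) - f (Inf K))) < e"
  \<comment> \<open>The summand 1 in \<open>L + 1\<close> keeps the quotient meaningful when
    \<open>L = 0\<close>.\<close>
  proof (intro exI[of _ "e / (L + 1)"] conjI allI impI)
    show "e / (L + 1) > 0" using \<open>e > 0\<close> L by simp
    fix D assume D: "D division_of \<Union>D \<and> \<Union>D \<subseteq> {a..b} \<and> (\<Sum>K\<in>D. Sup K - Inf K) < e / (L + 1)"
    have "norm (f (Sup K) - f (Inf K)) \<le> L * (Sup K - Inf K) \<and> 0 \<le> Sup K - Inf K" if K: "K \<in> D" for K
    proof -
      obtain u v where "u \<le> v" "a \<le> u" "v \<le> b" "Inf K = u" "Sup K = v"
        using subinterval_endpoints[of K D a b] D K by blast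
      then show ?thesis
        using lipschitz_onD[OF assms, of v u] by (simp add: dist_norm)
    qed
    note * = this
    have nn: "0 \<le> (\<Sum>K\<in>D. Sup K - Inf K)"
      using * by (intro sum_nonneg) blast
    have "(\<Sum>K\<in>D. norm (f (Sup K) - f (Inf K))) \<le> (\<Sum>K\<in>D. L * (Sup K - Inf K))"
      using * by (intro sum_mono) blast
    also have "(\<Sum>K\<in>D. L * (Sup K - Inf K)) = L * (\<Sum>K\<in>D. Sup K - Inf K)"
      by (simp add: sum_distrib_left)
    also have "\<dots> \<le> (L + 1) * (\<Sum>K\<in>D. Sup K - Inf K)"
      using nn by (simp add: algebra_simps)
    also have "\<dots> < e"
      using D L by (simp add: field_simps)
    finally show "(\<Sum>K\<in>D. norm (f (Sup K) - f (Inf K))) < e" .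
  qed
qed

lemma AC_const: "absolutely_continuous_on_interval a b (\<lambda>x. c)"
  by (rule AC_lipschitz[of 0]) (simp add: lipschitz_on_def)

lemma AC_cong:
  assumes "absolutely_continuous_on_interval a b f" "\<And>x. a \<le> x \<Longrightarrow> x \<le> b \<Longrightarrow> f x = g x"
  shows "absolutely_continuous_on_interval a b g"
proof -
  have "(\<Sum>K\<in>D. norm (g (Sup K) - g (Inf K))) = (\<Sum>K\<in>D. norm (f (Sup K) - f (Inf K)))"
    if D: "D division_of \<Union>D" "\<Union>D \<subseteq> {a..b}" for D
  proof (rule sum.cong)
    fix K assume "K \<in> D"
    then obtain u v where "u \<le> v" "a \<le> u" "v \<le> b" "Inf K = u" "Sup K = v"
      by (rule subinterval_endpoints[OF _ D])
    then show "norm (g (Sup K) - g (Inf K)) = norm (f (Sup K) - f (Inf K))"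
      using assms(2) by simp
  qed simp
  then show ?thesis
    using assms(1) unfolding absolutely_continuous_on_interval_def by (simp cong: conj_cong imp_cong)
qed

lemma AC_imp_continuous_on:
  assumes "absolutely_continuous_on_interval a b f"
  shows "continuous_on {a..b} f"
proof -
  have "\<exists>d>0. \<forall>y\<in>{a..b}. dist y x < d \<longrightarrow> dist (f y) (f x) < e"
    if x: "x \<in> {a..b}" and e: "e > 0" for x e :: real
  proof -
    obtain d where "d > 0" and d: "\<And>D. D division_of \<Union>D \<Longrightarrow> \<Union>D \<subseteq> {a..b} \<Longrightarrow>
        (\<Sum>K\<in>D. Sup K - Inf K) < d \<Longrightarrow> (\<Sum>K\<in>D. norm (f (Sup K) - f (Inf K))) < e"
      using AC_obtain_delta[OF assms e] by blast
    \<comment> \<open>Absolute continuity is applied to the division with the single cell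
      \<open>{u..v}\<close>.\<close>
    have *: "norm (f v - f u) < e" if "u \<le> v" "v - u < d" "a \<le> u" "v \<le> b" for u v
      using d[of "{{u..v}}"] that division_of_self[of u v] by (simp add: cbox_interval)
    show ?thesis
    proof (intro exI[of _ d] conjI ballI impI)
      fix y assume y: "y \<in> {a..b}" "dist y x < d"
      then show "dist (f y) (f x) < e"
        using *[of x y] *[of y x] x
        by (cases "x \<le> y") (auto simp: dist_norm norm_minus_commute)
    qed fact
  qed
  then show ?thesis
    unfolding continuous_on_iff by blast
qed

text \<open>On each cell the increment of \<open>h\<close> is controlled by those of
  \<open>f\<close> and \<open>g\<close>, so \<open>e\<close> is halved and the weights are absorbed
  into the tolerances \<open>e / (2 * M)\<close> and \<open>e / (2 * N)\<close>. Sums and products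
  are both instances.\<close>

lemma AC_dominated:
  assumes f: "absolutely_continuous_on_interval a b f"
    and g: "absolutely_continuous_on_interval a b g"
    and h: "\<And>u v. a \<le> u \<Longrightarrow> u \<le> v \<Longrightarrow> v \<le> b \<Longrightarrow>
      norm (h v - h u) \<le> M * norm (f v - f u) + N * norm (g v - g u)"
    and M: "M > 0" and N: "N > 0"
  shows "absolutely_continuous_on_interval a b h"
  unfolding absolutely_continuous_on_interval_def
proof (intro allI impI)
  fix e :: real assume "e > 0"
  then have e: "e / (2 * M) > 0" "e / (2 * N) > 0" using M N by auto
  obtain d1 where "d1 > 0" and d1: "\<And>D. D division_of \<Union>D \<Longrightarrow> \<Union>D \<subseteq> {a..b} \<Longrightarrow>
      (\<Sum>K\<in>D. Sup K - Inf K) < d1 \<Longrightarrow> (\<Sum>K\<in>D. norm (f (Sup K) - f (Inf K))) < e / (2 * M)"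
    using AC_obtain_delta[OF f e(1)] by blast
  obtain d2 where "d2 > 0" and d2: "\<And>D. D division_of \<Union>D \<Longrightarrow> \<Union>D \<subseteq> {a..b} \<Longrightarrow>
      (\<Sum>K\<in>D. Sup K - Inf K) < d2 \<Longrightarrow> (\<Sum>K\<in>D. norm (g (Sup K) - g (Inf K))) < e / (2 * N)"
    using AC_obtain_delta[OF g e(2)] by blast
  show "\<exists>\<delta>>0. \<forall>D. D division_of \<Union>D \<and> \<Union>D \<subseteq> {a..b} \<and> (\<Sum>K\<in>D. Sup K - Inf K) < \<delta>
        \<longrightarrow> (\<Sum>K\<in>D. norm (h (Sup K) - h (Inf K))) < e"
  proof (intro exI[of _ "min d1 d2"] conjI allI impI)
    show "min d1 d2 > 0" using \<open>d1 > 0\<close> \<open>d2 > 0\<close> by simp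
    fix D assume D: "D division_of \<Union>D \<and> \<Union>D \<subseteq> {a..b} \<and> (\<Sum>K\<in>D. Sup K - Inf K) < min d1 d2"
    have "(\<Sum>K\<in>D. norm (h (Sup K) - h (Inf K)))
      \<le> (\<Sum>K\<in>D. M * norm (f (Sup K) - f (Inf K)) + N * norm (g (Sup K) - g (Inf K)))"
    proof (rule sum_mono)
      fix K assume "K \<in> D"
      then obtain u v where "u \<le> v" "a \<le> u" "v \<le> b" "Inf K = u" "Sup K = v"
        using subinterval_endpoints[of K D a b] D by metis
      then show "norm (h (Sup K) - h (Inf K))
          \<le> M * norm (f (Sup K) - f (Inf K)) + N * norm (g (Sup K) - g (Inf K))"
        using h by simp
    qed
    also have "\<dots> = M * (\<Sum>K\<in>D. norm (f (Sup K) - f (Inf K)))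
        + N * (\<Sum>K\<in>D. norm (g (Sup K) - g (Inf K)))"
      by (simp add: sum.distrib sum_distrib_left)
    also have "\<dots> < M * (e / (2 * M)) + N * (e / (2 * N))"
      using d1[of D] d2[of D] D M N by (intro add_strict_mono mult_strict_left_mono) auto
    also have "\<dots> = e" using M N by simp
    finally show "(\<Sum>K\<in>D. norm (h (Sup K) - h (Inf K))) < e" .
  qed
qed

lemma AC_add:
  assumes "absolutely_continuous_on_interval a b f" "absolutely_continuous_on_interval a b g"
  shows "absolutely_continuous_on_interval a b (\<lambda>x. f x + g x)"
proof (rule AC_dominated[OF assms, of _ 1 1])
  fix u v
  show "norm (f v + g v - (f u + g u)) \<le> 1 * norm (f v - f u) + 1 * norm (g v - g u)"
    using norm_triangle_ineq[of "f v - f u" "g v - g u"] by (simp add: algebra_simps)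
qed auto

lemma AC_mult:
  assumes f: "absolutely_continuous_on_interval a b f"
    and g: "absolutely_continuous_on_interval a b g"
  shows "absolutely_continuous_on_interval a b (\<lambda>x. f x * g x)"
proof -
  have "bounded (f ` {a..b})" "bounded (g ` {a..b})"
    using f g by (auto intro!: compact_imp_bounded compact_continuous_image AC_imp_continuous_on)
  then obtain M N where M: "M > 0" "\<And>x. x \<in> {a..b} \<Longrightarrow> norm (f x) \<le> M"
    and N: "N > 0" "\<And>x. x \<in> {a..b} \<Longrightarrow> norm (g x) \<le> N"
    unfolding bounded_pos by (metis imageI)
  show ?thesis
  \<comment> \<open>The bounds change places: the bound of \<open>g\<close> weights the increment of
    \<open>f\<close>, and conversely.\<close>
  proof (rule AC_dominated[OF f g _ N(1) M(1)])
    fix u v assume uv: "a \<le> u" "u \<le> v" "v \<le> b"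
    have "f v * g v - f u * g u = g v * (f v - f u) + f u * (g v - g u)"
      by (simp add: algebra_simps)
    then have "norm (f v * g v - f u * g u)
        \<le> norm (g v) * norm (f v - f u) + norm (f u) * norm (g v - g u)"
      by (metis norm_mult norm_triangle_ineq)
    also have "\<dots> \<le> N * norm (f v - f u) + M * norm (g v - g u)"
      using M(2)[of u] N(2)[of v] uv by (intro add_mono mult_right_mono) auto
    finally show "norm (f v * g v - f u * g u) \<le> N * norm (f v - f u) + M * norm (g v - g u)" .
  qed
qed

lemma AC_diff:
  assumes "absolutely_continuous_on_interval a b f" "absolutely_continuous_on_interval a b g"
  shows "absolutely_continuous_on_interval a b (\<lambda>x. f x - g x)"
  using AC_add[OF assms(1) AC_mult[OF AC_const[of _ _ "-1"] assms(2)]] by simp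

lemma AC_of_real: "absolutely_continuous_on_interval a b of_real"
  by (rule AC_lipschitz[of 1]) (simp add: lipschitz_on_def dist_of_real)

lemma AC_power:
  assumes "absolutely_continuous_on_interval a b f"
  shows "absolutely_continuous_on_interval a b (\<lambda>x. f x ^ n)"
  by (induction n) (auto intro: AC_const AC_mult assms)

text \<open>A negative exponent means a natural power of the inverse, and \<open>a > 0\<close> makes
  the inverse Lipschitz with constant \<open>1 / a^2\<close> on \<open>{a..b}\<close>.\<close>

lemma AC_powi:
  assumes "a > 0"
  shows "absolutely_continuous_on_interval a b (\<lambda>x. of_real x powi n)"
proof -
  have "(1 / a\<^sup>2)-lipschitz_on {a..b} (\<lambda>x. inverse (of_real x) :: complex)"
  proof (rule lipschitz_onI)
    fix x y assume xy: "x \<in> {a..b}" "y \<in> {a..b}"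
    then have pos: "x > 0" "y > 0" using assms by auto
    have "dist (inverse (of_real x)) (inverse (of_real y) :: complex) = dist (inverse x) (inverse y)"
      by (metis dist_of_real of_real_inverse)
    also have "\<dots> = dist x y / (x * y)"
      using pos by (simp add: dist_real_def inverse_eq_divide diff_frac_eq abs_mult abs_minus_commute)
    also have "\<dots> \<le> dist x y / a\<^sup>2"
      using xy assms by (intro divide_left_mono) (auto simp: power2_eq_square intro!: mult_mono)
    finally show "dist (inverse (of_real x)) (inverse (of_real y) :: complex) \<le> 1 / a\<^sup>2 * dist x y"
      by simp
  qed simp
  then show ?thesis
    unfolding power_int_def
    by (cases "n \<ge> 0") (auto intro: AC_power AC_of_real AC_lipschitz)
qed

text \<open>The exceptional null set is enclosed in an open set of measure below the delta of
  absolute continuity. A tagged division fine for a suitable gauge telescopes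
  \<open>f b - f a\<close>, and the cells tagged inside and outside the null set are estimated
  separately.\<close>

lemma AC_derivative_zero_imp_eq:
  assumes ac: "absolutely_continuous_on_interval a b f" and "a \<le> b"
    and deriv: "AE x in lebesgue. a < x \<and> x < b \<longrightarrow> (f has_vector_derivative 0) (at x)"
  shows "f b = f a"
proof -
  \<comment> \<open>The share of the exceptional cells is \<open>e\<close>, that of the remaining
    ones \<open>e * (b - a)\<close>.\<close>
  have le: "norm (f b - f a) \<le> e * (1 + (b - a))" if "e > 0" for e
  proof -
    obtain \<delta> where "\<delta> > 0" and \<delta>: "\<And>D. D division_of \<Union>D \<Longrightarrow> \<Union>D \<subseteq> {a..b} \<Longrightarrow>
        (\<Sum>K\<in>D. Sup K - Inf K) < \<delta> \<Longrightarrow> (\<Sum>K\<in>D. norm (f (Sup K) - f (Inf K))) < e"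
      using AC_obtain_delta[OF ac \<open>e > 0\<close>] by blast
    obtain N0 where N0: "N0 \<in> null_sets lebesgue"
      and sub: "{x \<in> space lebesgue. \<not> (a < x \<and> x < b \<longrightarrow> (f has_vector_derivative 0) (at x))} \<subseteq> N0"
      using deriv unfolding eventually_ae_filter by blast
    \<comment> \<open>The endpoints are added because the derivative is given on the open interval,
      while \<open>a\<close> or \<open>b\<close> may occur as tags.\<close>
    define N where "N = N0 \<union> {a, b}"
    have "{a, b} \<in> null_sets lebesgue"
      by (intro negligible_iff_null_sets[THEN iffD1] negligible_finite) simp
    then have N: "N \<in> null_sets lebesgue"
      using N0 unfolding N_def by blast
    obtain U where U: "open U" "N \<subseteq> U" "U - N \<in> lmeasurable" "emeasure lebesgue (U - N) < ennreal \<delta>"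
      using sets_lebesgue_outer_open[of N \<delta>] N \<open>\<delta> > 0\<close> by blast
    have UN: "U = (U - N) \<union> N" using U(2) by blast
    have emU: "emeasure lebesgue U < ennreal \<delta>"
      using U(3,4) N by (subst UN) (simp add: emeasure_Un_null_set del: Un_Diff_cancel2)
    then have Um: "U \<in> lmeasurable"
      using \<open>open U\<close> by (intro fmeasurableI) (auto simp: borel_open intro: less_trans)
    have mU: "measure lebesgue U < \<delta>"
      using emU \<open>\<delta> > 0\<close> unfolding emeasure_eq_measure2[OF Um] by (simp add: ennreal_less_iff)
    have "\<exists>d>0. \<forall>y. \<bar>y - x\<bar> < d \<longrightarrow> norm (f y - f x) \<le> e * \<bar>y - x\<bar>"
      if "x \<in> {a..b} - N" for x
    proof -
      have "(f has_vector_derivative 0) (at x)"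
        using that sub unfolding N_def by force
      then show ?thesis
        using \<open>e > 0\<close> unfolding has_vector_derivative_def has_derivative_at_alt by auto
    qed
    then obtain d where d: "\<And>x. x \<in> {a..b} - N \<Longrightarrow> d x > 0"
      "\<And>x y. x \<in> {a..b} - N \<Longrightarrow> \<bar>y - x\<bar> < d x \<Longrightarrow> norm (f y - f x) \<le> e * \<bar>y - x\<bar>"
      by metis
    \<comment> \<open>The cells tagged in the exceptional set lie in \<open>U\<close> and are handled by absolute continuity;
      on the others the vanishing derivative at the tag makes the increment small.\<close>
    define g where "g x = (if x \<in> N then U else if x \<in> {a..b} then ball x (d x) else UNIV)" for x
    have "gauge g"
      using U d(1) unfolding g_def gauge_def by auto
    then obtain p where p: "p tagged_division_of {a..b}" "g fine p"
      by (rule fine_division_exists_real)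
    note pD = tagged_division_ofD[OF p(1)]
    define q where "q = {xk \<in> p. fst xk \<in> N}"
    have "q tagged_partial_division_of {a..b}"
      using p(1) by (auto simp: q_def tagged_division_of_def intro: tagged_partial_division_subset)
    then have qdiv: "q tagged_division_of \<Union>(snd ` q)"
      by (rule tagged_partial_division_of_Union_self)
    note Ddiv = division_of_tagged_division[OF qdiv]
    have Dsub: "\<Union>(snd ` q) \<subseteq> {a..b}"
      using pD(3) by (force simp: q_def)
    have "(\<Sum>K\<in>snd ` q. Sup K - Inf K) = (\<Sum>K\<in>snd ` q. measure lebesgue K)"
    proof (rule sum.cong)
      fix K assume "K \<in> snd ` q"
      then obtain u v where "K = {u..v}" "u \<le> v" "Inf K = u" "Sup K = v"
        by (rule subinterval_endpoints[of K "snd ` q" a b]) (use Ddiv Dsub in auto)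
      then show "Sup K - Inf K = measure lebesgue K" by simp
    qed simp
    also have "\<dots> = measure lebesgue (\<Union>(snd ` q))"
      using Ddiv by (simp add: content_division)
    also have "\<dots> \<le> measure lebesgue U"
    proof (rule measure_mono_fmeasurable)
      show "\<Union>(snd ` q) \<subseteq> U"
        using p(2) unfolding fine_def g_def q_def by force
      show "\<Union>(snd ` q) \<in> sets lebesgue"
        using lmeasurable_division[OF Ddiv] by auto
    qed (fact Um)
    finally have "(\<Sum>K\<in>snd ` q. Sup K - Inf K) < \<delta>"
      using mU by simp
    from \<delta>[OF Ddiv Dsub this] have Dle: "(\<Sum>K\<in>snd ` q. norm (f (Sup K) - f (Inf K))) < e" .
    \<comment> \<open>\<open>Sup {}\<close> and \<open>Inf {}\<close> are unspecified reals, so the empty cell is excluded explicitly.\<close>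
    define F where "F K = (if K = {} then 0 else norm (f (Sup K) - f (Inf K)))" for K
    have ne: "K \<noteq> {}" if "(x, K) \<in> p" for x K
      using pD(2)[OF that] by blast
    \<comment> \<open>Two tagged pairs can share a cell only if its interior is empty, and there
      \<open>F\<close> vanishes, so nothing is lost by summing over the set of cells.\<close>
    have "(\<Sum>(x, K)\<in>q. F K) = (\<Sum>K\<in>snd ` q. F K)"
      by (rule sum.over_tagged_division_lemma[OF qdiv]) (auto simp: F_def box_eq_empty cbox_interval)
    also have "\<dots> = (\<Sum>K\<in>snd ` q. norm (f (Sup K) - f (Inf K)))"
      using ne by (intro sum.cong) (auto simp: F_def q_def)
    finally have qle: "(\<Sum>(x, K)\<in>q. F K) < e"
      using Dle by simp
    have "(\<Sum>(x, K)\<in>p - q. F K) \<le> (\<Sum>(x, K)\<in>p - q. e * (Sup K - Inf K))"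
    proof (rule sum_mono, clarify)
      fix x K assume xK: "(x, K) \<in> p" "(x, K) \<notin> q"
      then have x: "x \<in> {a..b} - N"
        using pD(2,3)[OF xK(1)] by (auto simp: q_def)
      obtain u v where K: "K = cbox u v" using pD(4) xK by blast
      have "x \<in> K" using pD(2) xK by blast
      then have uv: "u \<le> x" "x \<le> v" "Inf K = u" "Sup K = v"
        using K by (auto simp: cbox_interval)
      have "K \<subseteq> g x"
        using p(2) xK(1) unfolding fine_def by blast
      then have "K \<subseteq> ball x (d x)"
        using x by (simp add: g_def)
      moreover have "u \<in> K" "v \<in> K"
        using K uv by auto
      ultimately have "\<bar>u - x\<bar> < d x" "\<bar>v - x\<bar> < d x"
        by (auto simp: dist_real_def abs_minus_commute)
      then have "norm (f u - f x) \<le> e * \<bar>u - x\<bar>" "norm (f v - f x) \<le> e * \<bar>v - x\<bar>"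
        using d(2)[OF x, of u] d(2)[OF x, of v] by blast+
      \<comment> \<open>As \<open>u \<le> x \<le> v\<close>, the two bounds add up to
        \<open>e\<close> times the length of the cell.\<close>
      then have "norm (f v - f u) \<le> e * (v - u)"
        using norm_triangle_ineq4[of "f v - f x" "f u - f x"] uv by (simp add: algebra_simps)
      then show "F K \<le> e * (Sup K - Inf K)"
        using ne[OF xK(1)] uv by (simp add: F_def)
    qed
    also have "\<dots> \<le> (\<Sum>(x, K)\<in>p. e * (Sup K - Inf K))"
    proof (rule sum_mono2)
      show "0 \<le> (case xK of (x, K) \<Rightarrow> e * (Sup K - Inf K))" if xK: "xK \<in> p - (p - q)" for xK
      proof -
        obtain x K where "xK = (x, K)" "(x, K) \<in> p" using xK by (cases xK) auto
        moreover from pD(2)[OF this(2)] pD(4)[OF this(2)] obtain u v where "K = cbox u v" "x \<in> K"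
          by blast
        ultimately show ?thesis
          using \<open>e > 0\<close> by (auto simp: cbox_interval)
      qed
    qed (use pD(1) in auto)
    also have "\<dots> = e * (\<Sum>(x, K)\<in>p. Sup K - Inf K)"
      by (simp add: sum_distrib_left case_prod_unfold)
    also have "\<dots> = e * (b - a)"
      using additive_tagged_division_1[OF \<open>a \<le> b\<close> p(1), of "\<lambda>x. x"] by simp
    finally have pqle: "(\<Sum>(x, K)\<in>p - q. F K) \<le> e * (b - a)" .
    have "norm (f b - f a) = norm (\<Sum>(x, K)\<in>p. f (Sup K) - f (Inf K))"
      using additive_tagged_division_1[OF \<open>a \<le> b\<close> p(1), of f] by simp
    also have "\<dots> \<le> (\<Sum>(x, K)\<in>p. F K)"
      using ne by (intro sum_norm_le) (auto simp: F_def)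
    also have "\<dots> = (\<Sum>(x, K)\<in>p - q. F K) + (\<Sum>(x, K)\<in>q. F K)"
      using pD(1) by (intro sum.subset_diff) (auto simp: q_def)
    finally show ?thesis
      using qle pqle by (simp add: algebra_simps)
  qed
  have "norm (f b - f a) \<le> 0"
  proof (rule field_le_epsilon)
    fix e :: real assume "e > 0"
    then show "norm (f b - f a) \<le> 0 + e"
      using le[of "e / (1 + (b - a))"] \<open>a \<le> b\<close> by simp
  qed
  then show ?thesis by simp
qed

section \<open>Indefinite Lebesgue integrals\<close>

text \<open>Lebesgue's differentiation theorem: off a null set the one-sided averages of the
  integrand converge to its value, and such averages are the difference quotients of the indefinite
  integral.\<close>

lemma AE_has_vector_derivative_indefinite_integral:
  fixes f :: "real \<Rightarrow> 'b::euclidean_space"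
  assumes int: "\<And>b. f integrable_on {a..b}"
  shows "AE x in lebesgue. a < x \<longrightarrow> ((\<lambda>u. integral {a..u} f) has_vector_derivative f x) (at x)"
proof -
  \<comment> \<open>Extension by zero gives a function integrable on every compact interval, as the
    averaging theorem requires, and changes nothing to the right of \<open>a\<close>.\<close>
  define g where "g x = (if x \<in> {a..} then f x else 0)" for x
  have gint: "g integrable_on cbox c d" for c d
  proof -
    have "{a..} \<inter> cbox c d = {max a c..d}" by auto
    moreover have "f integrable_on {max a c..d}"
      by (rule integrable_on_subinterval[OF int[of d]]) auto
    ultimately show ?thesis
      unfolding g_def by (simp only: integrable_restrict_Int)
  qed
  have gint': "(\<lambda>x. g (- x)) integrable_on cbox c d" for c d
    using integrable_reflect[of g "-c" "-d"] gint by simp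
  obtain N1 where N1: "negligible N1"
    "\<And>x e. x \<notin> N1 \<Longrightarrow> 0 < e \<Longrightarrow> \<exists>d>0. \<forall>h. 0 < h \<and> h < d \<longrightarrow>
        norm (integral (cbox x (x + h *\<^sub>R One)) g /\<^sub>R h ^ DIM(real) - g x) < e"
    using integrable_ccontinuous_explicit[of g] gint by metis
  \<comment> \<open>The library gives right derivatives only; left ones come from the reflected function.\<close>
  obtain N2 where N2: "negligible N2"
    "\<And>x e. x \<notin> N2 \<Longrightarrow> 0 < e \<Longrightarrow> \<exists>d>0. \<forall>h. 0 < h \<and> h < d \<longrightarrow>
        norm (integral (cbox x (x + h *\<^sub>R One)) (\<lambda>x. g (- x)) /\<^sub>R h ^ DIM(real) - g (- x)) < e"
    using integrable_ccontinuous_explicit[of "\<lambda>x. g (- x)"] gint' by metis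
  \<comment> \<open>\<open>N2\<close> lives in the reflected coordinate; reflection is
    differentiable and therefore maps null sets to null sets.\<close>
  have "negligible (uminus ` N2)"
    by (rule negligible_differentiable_image_negligible[OF order_refl N2(1)])
      (auto intro: differentiable_on_minus differentiable_on_ident)
  then have neg: "N1 \<union> uminus ` N2 \<in> null_sets lebesgue"
    using N1(1) by (metis negligible_Un negligible_iff_null_sets)
  have "((\<lambda>u. integral {a..u} f) has_vector_derivative f x) (at x)"
    if x: "x \<notin> N1 \<union> uminus ` N2" "a < x" for x
    unfolding has_vector_derivative_def has_derivative_at_alt
  proof (intro conjI allI impI bounded_linear_scaleR_left)
    fix e :: real assume "e > 0"
    have "x \<notin> N1" "- x \<notin> N2" using x by force+
    from N1(2)[OF this(1) \<open>e > 0\<close>] obtain d1 where "d1 > 0" and d1: "\<And>h. 0 < h \<Longrightarrow> h < d1 \<Longrightarrow>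
        norm (integral {x..x + h} g /\<^sub>R h - g x) < e"
      by (auto simp: cbox_interval)
    from N2(2)[OF \<open>- x \<notin> N2\<close> \<open>e > 0\<close>] obtain d2 where "d2 > 0" and d2: "\<And>h. 0 < h \<Longrightarrow> h < d2 \<Longrightarrow>
        norm (integral {- x..- x + h} (\<lambda>x. g (- x)) /\<^sub>R h - g x) < e"
      by (auto simp: cbox_interval)
    have d2': "norm (integral {x - h..x} g /\<^sub>R h - g x) < e" if "0 < h" "h < d2" for h
      using d2[OF that] Henstock_Kurzweil_Integration.integral_reflect_real[of x "x - h" g]
      by (simp add: algebra_simps)
    have eq: "integral {u..v} g = integral {u..v} f" if "a < u" for u v
      using that by (intro integral_cong) (auto simp: g_def)
    have incr: "integral {a..v} f - integral {a..u} f = integral {u..v} g" if "a < u" "u \<le> v" for u v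
      using Henstock_Kurzweil_Integration.integral_combine[of a u v f] int that eq[of u v]
      by (simp add: algebra_simps)
    have scale: "norm (I - h *\<^sub>R g x) \<le> e * h" if "norm (I /\<^sub>R h - g x) < e" "h > 0" for I h
    proof -
      have "I - h *\<^sub>R g x = h *\<^sub>R (I /\<^sub>R h - g x)"
        using that(2) by (simp add: algebra_simps)
      then show ?thesis using that by (simp add: mult.commute)
    qed
    have gx: "g x = f x" using x by (simp add: g_def)
    show "\<exists>d>0. \<forall>y. norm (y - x) < d \<longrightarrow>
        norm (integral {a..y} f - integral {a..x} f - (y - x) *\<^sub>R f x) \<le> e * norm (y - x)"
    \<comment> \<open>The bound \<open>x - a\<close> keeps \<open>y\<close> to the right of
      \<open>a\<close>, where \<open>g\<close> and \<open>f\<close> agree.\<close>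
    proof (intro exI[of _ "min (min d1 d2) (x - a)"] conjI allI impI)
      show "min (min d1 d2) (x - a) > 0"
        using \<open>d1 > 0\<close> \<open>d2 > 0\<close> x by simp
      fix y assume y: "norm (y - x) < min (min d1 d2) (x - a)"
      consider "y = x" | "y > x" | "y < x" by linarith
      then show "norm (integral {a..y} f - integral {a..x} f - (y - x) *\<^sub>R f x) \<le> e * norm (y - x)"
      proof cases
        case 2
        then show ?thesis
          using scale[OF d1[of "y - x"]] incr[of x y] x y gx by simp
      next
        case 3
        have "norm (integral {y..x} g - (x - y) *\<^sub>R g x) \<le> e * (x - y)"
          using scale[OF d2'[of "x - y"]] 3 y by simp
        moreover have "integral {a..y} f - integral {a..x} f - (y - x) *\<^sub>R f x
            = - (integral {y..x} g - (x - y) *\<^sub>R g x)"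
          using incr[of y x] 3 y gx by (simp add: algebra_simps)
        ultimately show ?thesis using 3 by (simp only: norm_minus_cancel) simp
      qed simp
    qed
  qed
  then show ?thesis
    by (intro AE_I'[OF neg]) auto
qed

lemma AC_indefinite_integral:
  fixes f :: "real \<Rightarrow> complex"
  assumes "f absolutely_integrable_on {a..b}"
  shows "absolutely_continuous_on_interval a b (\<lambda>u. integral {a..u} f)"
  unfolding absolutely_continuous_on_interval_def
proof (intro allI impI)
  fix e :: real assume "e > 0"
  \<comment> \<open>Up to the excess \<open>h n\<close>, whose integral tends to \<open>0\<close>, the norm of \<open>f\<close> is bounded by \<open>n\<close>.\<close>
  define h where "h n x = max (norm (f x) - real n) 0" for n x
  have fint: "f integrable_on {a..b}" and nint: "(\<lambda>x. norm (f x)) integrable_on {a..b}"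
    using assms by (auto simp: absolutely_integrable_on_def)
  have hint: "h n integrable_on {a..b}" for n
  proof -
    have "(\<lambda>x. norm (f x) - real n) absolutely_integrable_on {a..b}"
      using absolutely_integrable_norm[OF assms] by (intro set_integral_diff) (auto simp: o_def)
    then have "(\<lambda>x. max (norm (f x) - real n) 0) absolutely_integrable_on {a..b}"
      by (rule absolutely_integrable_max_1) simp
    then show ?thesis unfolding h_def absolutely_integrable_on_def by blast
  qed
  have "(\<lambda>n. integral {a..b} (h n)) \<longlonglongrightarrow> integral {a..b} (\<lambda>x. 0)"
  proof (rule dominated_convergence(2)[OF hint nint])
    fix x assume "x \<in> {a..b}"
    obtain m :: nat where m: "norm (f x) \<le> real m" using real_arch_simple by blast
    have "eventually (\<lambda>n. h n x = 0) sequentially"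
      using eventually_ge_at_top[of m] by eventually_elim (use m in \<open>auto simp: h_def\<close>)
    then show "(\<lambda>n. h n x) \<longlonglongrightarrow> 0" by (simp add: tendsto_eventually)
  qed (auto simp: h_def)
  then have "eventually (\<lambda>n. integral {a..b} (h n) < e / 2) sequentially"
    using \<open>e > 0\<close> by (intro order_tendstoD(2)[where y = "integral {a..b} (\<lambda>x. 0)"]) auto
  then obtain n where n: "integral {a..b} (h n) < e / 2"
    by (auto simp: eventually_sequentially)
  show "\<exists>\<delta>>0. \<forall>D. D division_of \<Union>D \<and> \<Union>D \<subseteq> {a..b} \<and> (\<Sum>K\<in>D. Sup K - Inf K) < \<delta>
      \<longrightarrow> (\<Sum>K\<in>D. norm (integral {a..Sup K} f - integral {a..Inf K} f)) < e"
  \<comment> \<open>The excess consumes one half of \<open>e\<close>, the part bounded by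
    \<open>n\<close> the other; \<open>real n + 1\<close> is positive even when
    \<open>n = 0\<close>.\<close>
  proof (intro exI[of _ "e / (2 * (real n + 1))"] conjI allI impI)
    show "e / (2 * (real n + 1)) > 0" using \<open>e > 0\<close> by simp
    fix D assume "D division_of \<Union>D \<and> \<Union>D \<subseteq> {a..b} \<and> (\<Sum>K\<in>D. Sup K - Inf K) < e / (2 * (real n + 1))"
    then have D: "D division_of \<Union>D" "\<Union>D \<subseteq> {a..b}"
      and small: "(\<Sum>K\<in>D. Sup K - Inf K) < e / (2 * (real n + 1))" by blast+
    have *: "norm (integral {a..Sup K} f - integral {a..Inf K} f)
        \<le> integral K (h n) + real n * (Sup K - Inf K) \<and> 0 \<le> Sup K - Inf K" if KD: "K \<in> D" for K
    proof -
      from KD obtain u v where K: "K = {u..v}" "u \<le> v" "a \<le> u" "v \<le> b" "Inf K = u" "Sup K = v"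
        by (rule subinterval_endpoints[OF _ D])
      have sub: "g integrable_on {u..v}" if "g integrable_on {a..b}" for g :: "real \<Rightarrow> 'c::banach"
        using that K by (rule_tac integrable_on_subinterval) auto
      have "f integrable_on {a..v}"
        using fint K by (rule_tac integrable_on_subinterval) auto
      then have "integral {a..v} f - integral {a..u} f = integral {u..v} f"
        using Henstock_Kurzweil_Integration.integral_combine[of a u v f] K by (simp add: algebra_simps)
      also have "norm \<dots> \<le> integral {u..v} (\<lambda>x. norm (f x))"
        by (intro integral_norm_bound_integral sub fint nint) auto
      also have "\<dots> \<le> integral {u..v} (\<lambda>x. h n x + real n)"
        by (intro integral_le sub nint integrable_add hint) (auto simp: h_def)
      also have "\<dots> = integral {u..v} (h n) + integral {u..v} (\<lambda>x. real n)"
        by (intro integral_add sub hint) auto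
      also have "integral {u..v} (\<lambda>x. real n) = real n * (v - u)"
        using K by simp
      finally show ?thesis using K by simp
    qed
    then have nn: "0 \<le> (\<Sum>K\<in>D. Sup K - Inf K)"
      by (intro sum_nonneg) blast
    have hD: "(h n has_integral (\<Sum>K\<in>D. integral K (h n))) (\<Union>D)"
      using hint D by (rule has_integral_combine_division_topdown)
    have "(\<Sum>K\<in>D. norm (integral {a..Sup K} f - integral {a..Inf K} f))
        \<le> (\<Sum>K\<in>D. integral K (h n) + real n * (Sup K - Inf K))"
      using * by (intro sum_mono) blast
    also have "\<dots> = integral (\<Union>D) (h n) + real n * (\<Sum>K\<in>D. Sup K - Inf K)"
      unfolding integral_unique[OF hD] by (simp only: sum.distrib sum_distrib_left)
    also have "\<dots> \<le> integral {a..b} (h n) + (real n + 1) * (\<Sum>K\<in>D. Sup K - Inf K)"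
    proof (rule add_mono)
      show "integral (\<Union>D) (h n) \<le> integral {a..b} (h n)"
        using hD D(2) hint by (intro integral_subset_le) (auto simp: h_def)
      show "real n * (\<Sum>K\<in>D. Sup K - Inf K) \<le> (real n + 1) * (\<Sum>K\<in>D. Sup K - Inf K)"
        using nn by (intro mult_right_mono) auto
    qed
    also have "\<dots> < e / 2 + e / 2"
    proof (rule add_strict_mono[OF n])
      show "(real n + 1) * (\<Sum>K\<in>D. Sup K - Inf K) < e / 2"
        using small pos_less_divide_eq[of "2 * (real n + 1)" "\<Sum>K\<in>D. Sup K - Inf K" e]
        by (simp add: mult_ac del: distrib_left_numeral)
    qed
    finally show "(\<Sum>K\<in>D. norm (integral {a..Sup K} f - integral {a..Inf K} f)) < e" by simp
  qed
qed

text \<open>The endpoints form a null set, so the Lebesgue integral over the open interval is the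
  gauge integral over the closed one, to which the two preceding results apply.\<close>

lemma indefinite_set_integral:
  fixes f :: "real \<Rightarrow> complex"
  assumes f: "\<And>b. set_integrable lebesgue {a<..<b} f"
  shows AC_indefinite_set_integral:
      "absolutely_continuous_on_interval a b (\<lambda>r. LINT s:{a<..<r}|lebesgue. f s)"
    and AE_has_vector_derivative_indefinite_set_integral:
      "AE x in lebesgue. a < x \<longrightarrow>
        ((\<lambda>r. LINT s:{a<..<r}|lebesgue. f s) has_vector_derivative f x) (at x)"
proof -
  have abs: "f absolutely_integrable_on {a..b}" for b
    using f[of b] absolutely_integrable_on_Icc_iff_Ioo by blast
  have eq: "(\<lambda>r. LINT s:{a<..<r}|lebesgue. f s) = (\<lambda>r. integral {a..r} f)"
  proof
    fix r
    show "(LINT s:{a<..<r}|lebesgue. f s) = integral {a..r} f"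
      using set_lebesgue_integral_eq_integral(2)[OF f] by (simp add: integral_open_interval_real)
  qed
  show "absolutely_continuous_on_interval a b (\<lambda>r. LINT s:{a<..<r}|lebesgue. f s)"
    unfolding eq by (rule AC_indefinite_integral[OF abs])
  show "AE x in lebesgue. a < x \<longrightarrow>
      ((\<lambda>r. LINT s:{a<..<r}|lebesgue. f s) has_vector_derivative f x) (at x)"
    unfolding eq
    by (rule AE_has_vector_derivative_indefinite_integral)
      (rule set_lebesgue_integral_eq_integral(1)[OF abs])
qed

text \<open>The pieces \<open>{a<..<r}\<close> and \<open>{r<..}\<close> miss at most the null set
  \<open>{r}\<close>. This trades the moving lower limit of a tail for the moving upper limit of an
  indefinite integral, whose derivative and absolute continuity are known.\<close>

lemma set_integral_tail:
  fixes f :: "real \<Rightarrow> complex"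
  assumes f: "set_integrable lebesgue {a<..} f" and "a \<le> r"
  shows "(LINT s:{r<..}|lebesgue. f s)
      = (LINT s:{a<..}|lebesgue. f s) - (LINT s:{a<..<r}|lebesgue. f s)"
proof -
  have f1: "set_integrable lebesgue {a<..<r} f" and f2: "set_integrable lebesgue {r<..} f"
    using \<open>a \<le> r\<close> by (auto intro: set_integrable_subset[OF f])
  have "{r} \<in> null_sets lebesgue"
    by (intro negligible_iff_null_sets[THEN iffD1]) simp
  then have "AE s in lebesgue. s \<noteq> r"
    using AE_not_in[of "{r}" lebesgue] by simp
  then have AE: "AE s in lebesgue. (s \<in> {a<..<r} \<union> {r<..}) = (s \<in> {a<..})"
    by eventually_elim (use \<open>a \<le> r\<close> in auto)
  have "set_integrable lebesgue ({a<..<r} \<union> {r<..}) f"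
    using f1 f2 by (intro set_integrable_Un) auto
  then have "(LINT s:{a<..}|lebesgue. f s) = (LINT s:{a<..<r} \<union> {r<..}|lebesgue. f s)"
    using f AE unfolding set_integrable_def
    by (intro set_integral_cong_set) (simp_all only: set_borel_measurable_def borel_measurable_integrable)
  also have "\<dots> = (LINT s:{a<..<r}|lebesgue. f s) + (LINT s:{r<..}|lebesgue. f s)"
    using f1 f2 by (intro set_integral_Un) auto
  finally show ?thesis by simp
qed

text \<open>On \<open>S\<close> the weight factors as
  \<open>s powi n = s powr (n - \<alpha>) * s powr \<alpha>\<close>; the first factor is at most
  \<open>C\<close>, and \<open>w\<close> is integrable against the second.\<close>

lemma weighted_set_integral:
  fixes w :: "real \<Rightarrow> complex" and n :: int
  assumes w: "set_integrable lebesgue {a<..} (\<lambda>s. w s * of_real (s powr \<alpha>))" and "a > 0"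
    and S: "S \<in> sets lebesgue" "S \<subseteq> {a<..}"
    and C: "\<And>s. s \<in> S \<Longrightarrow> s powr (of_int n - \<alpha>) \<le> C" "0 \<le> C"
  shows weighted_set_integrable: "set_integrable lebesgue S (\<lambda>s. of_real s powi n * w s)"
    and weighted_set_integral_bound: "norm (LINT s:S|lebesgue. of_real s powi n * w s)
      \<le> C * (LINT s:{a<..}|lebesgue. norm (w s * of_real (s powr \<alpha>)))"
proof -
  define g where "g s = indicator S s *\<^sub>R (w s * of_real (s powr \<alpha>))" for s
  have g: "integrable lebesgue g"
    using set_integrable_subset[OF w S] unfolding set_integrable_def g_def .
  have eq: "indicator S s *\<^sub>R (of_real s powi n * w s) = of_real (s powr (of_int n - \<alpha>)) * g s" for s
  proof (cases "s \<in> S")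
    case True
    then have "s > 0" using S(2) \<open>a > 0\<close> by auto
    then have "complex_of_real s powi n = of_real (s powr of_int n)"
      by (simp add: powr_real_of_int' of_real_power_int)
    also have "s powr of_int n = s powr (of_int n - \<alpha>) * s powr \<alpha>"
      by (simp flip: powr_add)
    finally show ?thesis
      using True by (simp add: g_def)
  qed (simp add: g_def)
  have le: "norm (of_real (s powr (of_int n - \<alpha>)) * g s) \<le> norm (C *\<^sub>R g s)" for s
    using C mult_right_mono[of "s powr (of_int n - \<alpha>)" C "norm (g s)"]
    by (cases "s \<in> S") (auto simp: norm_mult g_def)
  have "(\<lambda>s. complex_of_real (s powr (of_int n - \<alpha>))) \<in> borel_measurable lborel"
    by measurable
  then have "(\<lambda>s. complex_of_real (s powr (of_int n - \<alpha>))) \<in> borel_measurable lebesgue"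
    by (rule measurable_completion)
  then have "(\<lambda>s. of_real (s powr (of_int n - \<alpha>)) * g s) \<in> borel_measurable lebesgue"
    using borel_measurable_integrable[OF g] by (rule borel_measurable_times)
  then have h: "integrable lebesgue (\<lambda>s. of_real (s powr (of_int n - \<alpha>)) * g s)"
    by (rule Bochner_Integration.integrable_bound[OF integrable_scaleR_right[OF g, of C]])
      (intro AE_I2 le)
  then show "set_integrable lebesgue S (\<lambda>s. of_real s powi n * w s)"
    unfolding set_integrable_def eq .
  have "norm (LINT s:S|lebesgue. of_real s powi n * w s)
      \<le> (LINT s|lebesgue. norm (of_real (s powr (of_int n - \<alpha>)) * g s))"
    unfolding set_lebesgue_integral_def eq by (rule integral_norm_bound)
  also have "\<dots> \<le> (LINT s|lebesgue. C * norm (indicator {a<..} s *\<^sub>R (w s * of_real (s powr \<alpha>))))"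
  proof (rule Bochner_Integration.integral_mono)
    show "integrable lebesgue (\<lambda>s. norm (of_real (s powr (of_int n - \<alpha>)) * g s))"
      using h by (rule integrable_norm)
    show "integrable lebesgue (\<lambda>s. C * norm (indicator {a<..} s *\<^sub>R (w s * of_real (s powr \<alpha>))))"
      using w unfolding set_integrable_def by (intro integrable_mult_right integrable_norm)
    show "norm (of_real (s powr (of_int n - \<alpha>)) * g s)
        \<le> C * norm (indicator {a<..} s *\<^sub>R (w s * of_real (s powr \<alpha>)))" for s
    proof -
      have "norm (g s) \<le> norm (indicator {a<..} s *\<^sub>R (w s * of_real (s powr \<alpha>)))"
        using S(2) by (auto simp: g_def indicator_def)
      from mult_left_mono[OF this C(2)] le[of s] C(2) show ?thesis by simp
    qed
  qed
  also have "\<dots> = C * (LINT s:{a<..}|lebesgue. norm (w s * of_real (s powr \<alpha>)))"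
    unfolding set_lebesgue_integral_def by (simp add: norm_mult)
  finally show "norm (LINT s:S|lebesgue. of_real s powi n * w s)
      \<le> C * (LINT s:{a<..}|lebesgue. norm (w s * of_real (s powr \<alpha>)))" .
qed

lemma powi_eq_mult_powi:
  fixes z :: "'a::field"
  assumes "z \<noteq> 0"
  shows "z powi n = z * z powi (n - 1)"
  using power_int_add_1'[of z "n - 1"] assms by simp

lemma has_vector_derivative_powi:
  assumes "x \<noteq> 0"
  shows "((\<lambda>x. of_real x powi n :: complex) has_vector_derivative of_int n * of_real x powi (n - 1)) (at x)"
  by (rule has_vector_derivative_real_field) (use assms in \<open>auto intro!: derivative_eq_intros\<close>)

section \<open>The two modes of a Fourier coefficient\<close>

text \<open>Variation of constants: \<open>r powi (- m - 1)\<close> and, for the outer mode,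
  \<open>r powi (m - 1)\<close> solve the homogeneous equations \<open>(r P)' = - m P\<close> and
  \<open>(r Q)' = m Q\<close>; the integrals are their variable coefficients.\<close>

definition inner_mode :: "real \<Rightarrow> int \<Rightarrow> (real \<Rightarrow> complex) \<Rightarrow> real \<Rightarrow> complex" where
  "inner_mode a m w r =
     of_real r powi (- m - 1) * (LINT s:{a<..<r}|lebesgue. of_real s powi (m + 1) * w s)"

definition outer_mode :: "int \<Rightarrow> (real \<Rightarrow> complex) \<Rightarrow> real \<Rightarrow> complex" where
  "outer_mode m w r =
     of_real r powi (m - 1) * (LINT s:{r<..}|lebesgue. of_real s powi (- m + 1) * w s)"

lemma powr_tendsto_0:
  assumes "(0::real) < \<alpha>" "\<And>r. r \<ge> a \<Longrightarrow> norm (f r) \<le> C * r powr - \<alpha>"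
  shows "(f \<longlongrightarrow> (0::complex)) at_top"
proof (rule Lim_null_comparison)
  show "eventually (\<lambda>r. norm (f r) \<le> C * r powr - \<alpha>) at_top"
    using eventually_ge_at_top[of a] by eventually_elim (rule assms(2))
  show "((\<lambda>r. C * r powr - \<alpha>) \<longlongrightarrow> 0) at_top"
    using assms(1) by (intro tendsto_mult_right_zero tendsto_neg_powr filterlim_ident) auto
qed

lemma norm_of_real_powi: "r > 0 \<Longrightarrow> norm (complex_of_real r powi n) = r powr of_int n"
  by (simp add: norm_power_int powr_real_of_int')

lemma inner_mode_at_boundary: "inner_mode a m w a = 0"
  by (simp add: inner_mode_def set_lebesgue_integral_def)

context
  fixes a \<alpha> :: real and m :: int and w :: "real \<Rightarrow> complex"
  assumes a: "a > 0" and \<alpha>: "0 < \<alpha>" "\<alpha> \<le> of_int m + 1" "1 - of_int m \<le> \<alpha>"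
    and w: "set_integrable lebesgue {a<..} (\<lambda>s. w s * of_real (s powr \<alpha>))"
begin

text \<open>Because \<open>\<alpha> \<le> m + 1\<close>, the weight
  \<open>s powr (m + 1 - \<alpha>)\<close> is nondecreasing and thus bounded on
  \<open>{a<..<r}\<close> by its value at \<open>r\<close>.\<close>

lemma inner_integrand_integrable:
  "set_integrable lebesgue {a<..<r} (\<lambda>s. of_real s powi (m + 1) * w s)"
  by (rule weighted_set_integrable[OF w a, where C = "r powr (of_int (m + 1) - \<alpha>)"])
    (use a \<alpha> in \<open>auto intro!: powr_mono2\<close>)

text \<open>Because \<open>1 - m \<le> \<alpha>\<close>, the weight
  \<open>s powr (- m + 1 - \<alpha>)\<close> is nonincreasing and thus bounded on
  \<open>{r<..}\<close> by its value at \<open>r\<close>.\<close>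

lemma outer_integrand_integrable:
  assumes "r \<ge> a"
  shows "set_integrable lebesgue {r<..} (\<lambda>s. of_real s powi (- m + 1) * w s)"
  by (rule weighted_set_integrable[OF w a, where C = "r powr (of_int (- m + 1) - \<alpha>)"])
    (use a \<alpha> assms in \<open>auto intro!: powr_mono2'\<close>)

text \<open>The weight bound at \<open>r\<close>, multiplied by the prefactor with exponent
  \<open>- m - 1\<close>, leaves exactly the decay \<open>r powr - \<alpha>\<close>.\<close>

lemma inner_mode_tendsto_0: "(inner_mode a m w \<longlongrightarrow> 0) at_top"
proof (rule powr_tendsto_0[OF \<alpha>(1)])
  define I where "I = (LINT s:{a<..}|lebesgue. norm (w s * of_real (s powr \<alpha>)))"
  fix r assume r: "r \<ge> a"
  have "norm (LINT s:{a<..<r}|lebesgue. of_real s powi (m + 1) * w s) \<le> r powr (of_int (m + 1) - \<alpha>) * I"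
    unfolding I_def
    by (rule weighted_set_integral_bound[OF w a]) (use a r \<alpha> in \<open>auto intro!: powr_mono2\<close>)
  then have "norm (inner_mode a m w r) \<le> r powr of_int (- m - 1) * (r powr (of_int (m + 1) - \<alpha>) * I)"
    unfolding inner_mode_def norm_mult using r a
    by (intro mult_mono') (simp_all add: norm_of_real_powi)
  also have "\<dots> = (r powr of_int (- m - 1) * r powr (of_int (m + 1) - \<alpha>)) * I"
    by simp
  also have "r powr of_int (- m - 1) * r powr (of_int (m + 1) - \<alpha>) = r powr - \<alpha>"
    by (simp flip: powr_add)
  finally show "norm (inner_mode a m w r) \<le> I * r powr - \<alpha>" by (simp add: mult.commute)
qed

text \<open>The exponents cancel as for the inner mode:
  \<open>(m - 1) + (- m + 1 - \<alpha>) = - \<alpha>\<close>.\<close>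

lemma outer_mode_tendsto_0: "(outer_mode m w \<longlongrightarrow> 0) at_top"
proof (rule powr_tendsto_0[OF \<alpha>(1)])
  define I where "I = (LINT s:{a<..}|lebesgue. norm (w s * of_real (s powr \<alpha>)))"
  fix r assume r: "r \<ge> a"
  have "norm (LINT s:{r<..}|lebesgue. of_real s powi (- m + 1) * w s) \<le> r powr (of_int (- m + 1) - \<alpha>) * I"
    unfolding I_def
    by (rule weighted_set_integral_bound[OF w a]) (use a r \<alpha> in \<open>auto intro!: powr_mono2'\<close>)
  then have "norm (outer_mode m w r) \<le> r powr of_int (m - 1) * (r powr (of_int (- m + 1) - \<alpha>) * I)"
    unfolding outer_mode_def norm_mult using r a
    by (intro mult_mono') (simp_all add: norm_of_real_powi)
  also have "\<dots> = (r powr of_int (m - 1) * r powr (of_int (- m + 1) - \<alpha>)) * I"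
    by simp
  also have "r powr of_int (m - 1) * r powr (of_int (- m + 1) - \<alpha>) = r powr - \<alpha>"
    by (simp flip: powr_add)
  finally show "norm (outer_mode m w r) \<le> I * r powr - \<alpha>" by (simp add: mult.commute)
qed

lemma outer_integral_eq:
  assumes "r \<ge> a"
  shows "(LINT s:{r<..}|lebesgue. of_real s powi (- m + 1) * w s)
    = (LINT s:{a<..}|lebesgue. of_real s powi (- m + 1) * w s)
      - (LINT s:{a<..<r}|lebesgue. of_real s powi (- m + 1) * w s)"
  using assms by (intro set_integral_tail outer_integrand_integrable) auto

lemma outer_integrand_integrable': "set_integrable lebesgue {a<..<b} (\<lambda>s. of_real s powi (- m + 1) * w s)"
  by (rule set_integrable_subset[OF outer_integrand_integrable[OF order_refl]]) auto

lemma AC_inner_mode: "absolutely_continuous_on_interval a b (inner_mode a m w)"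
  unfolding inner_mode_def[abs_def]
  by (intro AC_mult AC_powi a AC_indefinite_set_integral inner_integrand_integrable)

text \<open>For \<open>r \<ge> a\<close> the tail is a constant minus an indefinite integral, so on
  the interval the mode is a product of absolutely continuous functions.\<close>

lemma AC_outer_mode: "absolutely_continuous_on_interval a b (outer_mode m w)"
proof (rule AC_cong)
  show "absolutely_continuous_on_interval a b (\<lambda>r. of_real r powi (m - 1) *
      ((LINT s:{a<..}|lebesgue. of_real s powi (- m + 1) * w s)
      - (LINT s:{a<..<r}|lebesgue. of_real s powi (- m + 1) * w s)))"
    by (intro AC_mult AC_diff AC_const AC_powi a AC_indefinite_set_integral outer_integrand_integrable')
  show "of_real x powi (m - 1) *
      ((LINT s:{a<..}|lebesgue. of_real s powi (- m + 1) * w s)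
      - (LINT s:{a<..<x}|lebesgue. of_real s powi (- m + 1) * w s)) = outer_mode m w x" if "a \<le> x" for x
    unfolding outer_mode_def outer_integral_eq[OF that] ..
qed

text \<open>Multiplication by \<open>r\<close> turns the prefactor into \<open>r powi (- m)\<close>.
  Differentiating it produces \<open>- m\<close> times the mode; in the other term of the product
  rule \<open>r powi (- m)\<close> and \<open>r powi (m + 1)\<close> combine to
  \<open>r\<close>.\<close>

lemma inner_mode_derivative:
  "AE r in lebesgue. a < r \<longrightarrow>
     ((\<lambda>s. of_real s * inner_mode a m w s) has_vector_derivative
       of_real r * w r - of_int m * inner_mode a m w r) (at r)"
  using AE_has_vector_derivative_indefinite_set_integral[OF inner_integrand_integrable]
proof eventually_elim
  case (elim r)
  show ?case
  proof
    assume r: "a < r"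
    let ?A = "\<lambda>r. LINT s:{a<..<r}|lebesgue. of_real s powi (m + 1) * w s"
    have "((\<lambda>s. of_real s powi (- m) * ?A s) has_vector_derivative
        of_real r powi (- m) * (of_real r powi (m + 1) * w r)
        + of_int (- m) * of_real r powi (- m - 1) * ?A r) (at r)"
      using elim r a by (intro has_vector_derivative_mult has_vector_derivative_powi) auto
    also have "of_real r powi (- m) * (of_real r powi (m + 1) * w r)
        + of_int (- m) * of_real r powi (- m - 1) * ?A r
        = of_real r * w r - of_int m * inner_mode a m w r"
    proof -
      have "complex_of_real r powi (- m) * of_real r powi (m + 1) = of_real r"
        using r a by (subst power_int_add[symmetric]) auto
      then show ?thesis by (simp add: inner_mode_def flip: mult.assoc)
    qed
    finally show "((\<lambda>s. of_real s * inner_mode a m w s) has_vector_derivative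
        of_real r * w r - of_int m * inner_mode a m w r) (at r)"
    \<comment> \<open>Splitting off the factor \<open>s\<close> relies on \<open>s > 0\<close>; an
      identity on the open set \<open>{a<..}\<close> around \<open>r\<close> suffices for the
      derivative.\<close>
    proof (rule has_vector_derivative_transform_within_open[where S = "{a<..}"])
      fix s assume "s \<in> {a<..}"
      then have "complex_of_real s powi (- m) = of_real s * of_real s powi (- m - 1)"
        using a by (intro powi_eq_mult_powi) simp
      then show "of_real s powi (- m) * ?A s = of_real s * inner_mode a m w s"
        by (simp add: inner_mode_def)
    qed (use r in auto)
  qed
qed

lemma outer_mode_derivative:
  "AE r in lebesgue. a < r \<longrightarrow>
     ((\<lambda>s. of_real s * outer_mode m w s) has_vector_derivative
       of_int m * outer_mode m w r - of_real r * w r) (at r)"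
  using AE_has_vector_derivative_indefinite_set_integral[OF outer_integrand_integrable']
proof eventually_elim
  case (elim r)
  show ?case
  proof
    assume r: "a < r"
    \<comment> \<open>\<open>?B\<close> is the tail rewritten with the fixed limit \<open>a\<close>,
      valid to the right of \<open>a\<close>; its derivative is the integrand with a minus
      sign.\<close>
    let ?B = "\<lambda>r. (LINT s:{a<..}|lebesgue. of_real s powi (- m + 1) * w s)
      - (LINT s:{a<..<r}|lebesgue. of_real s powi (- m + 1) * w s)"
    have "((\<lambda>s. of_real s powi m * ?B s) has_vector_derivative
        of_real r powi m * (0 - of_real r powi (- m + 1) * w r)
        + of_int m * of_real r powi (m - 1) * ?B r) (at r)"
      using elim r a
      by (intro has_vector_derivative_mult has_vector_derivative_powi has_vector_derivative_diff
          has_vector_derivative_const) auto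
    also have "of_real r powi m * (0 - of_real r powi (- m + 1) * w r)
        + of_int m * of_real r powi (m - 1) * ?B r
        = of_int m * outer_mode m w r - of_real r * w r"
    proof -
      have "complex_of_real r powi m * of_real r powi (- m + 1) = of_real r"
        using r a by (subst power_int_add[symmetric]) auto
      then show ?thesis
        using r outer_integral_eq[of r] by (simp add: outer_mode_def flip: mult.assoc)
    qed
    finally show "((\<lambda>s. of_real s * outer_mode m w s) has_vector_derivative
        of_int m * outer_mode m w r - of_real r * w r) (at r)"
    proof (rule has_vector_derivative_transform_within_open[where S = "{a<..}"])
      fix s assume s: "s \<in> {a<..}"
      then have "complex_of_real s powi m = of_real s * of_real s powi (m - 1)"
        using a by (intro powi_eq_mult_powi) simp
      then show "of_real s powi m * ?B s = of_real s * outer_mode m w s"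
        using s outer_integral_eq[of s] by (simp add: outer_mode_def)
    qed (use r in auto)
  qed
qed

end

section \<open>The div-curl system\<close>

text \<open>Beyond some \<open>R\<close> the function stays within distance 1 of its limit, and on
  \<open>{a..R}\<close> it is bounded by compactness; continuity on the open half-line gives
  measurability.\<close>

lemma essentially_bounded_on_of_AC:
  assumes ac: "\<And>R. absolutely_continuous_on_interval a R f" and lim: "(f \<longlongrightarrow> l) at_top"
  shows "essentially_bounded_on {a<..} f"
  unfolding essentially_bounded_on_def
proof
  have "continuous_on {a<..} f"
    unfolding continuous_on_eq_continuous_at[OF open_greaterThan]
  proof
    fix x assume "x \<in> {a<..}"
    moreover have "continuous_on {a<..<x + 1} f"
      by (rule continuous_on_subset[OF AC_imp_continuous_on[OF ac[of "x + 1"]]]) auto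
    ultimately show "isCont f x"
      by (auto simp: continuous_on_eq_continuous_at)
  qed
  then have "set_borel_measurable borel {a<..} f"
    by (intro set_measurable_continuous_on) auto
  then show "set_borel_measurable lebesgue {a<..} f"
    unfolding set_borel_measurable_def by (intro measurable_completion) simp
  have "eventually (\<lambda>r. dist (f r) l < 1) at_top"
    using lim by (rule tendstoD) simp
  then obtain R where R: "\<And>r. r \<ge> R \<Longrightarrow> dist (f r) l < 1"
    unfolding eventually_at_top_linorder by blast
  have "bounded (f ` {a..R})"
    by (intro compact_imp_bounded compact_continuous_image AC_imp_continuous_on ac) simp
  then obtain B where B: "\<And>r. r \<in> {a..R} \<Longrightarrow> norm (f r) \<le> B"
    unfolding bounded_iff by blast
  have "norm (f r) \<le> max B (norm l + 1)" if "r > a" for r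
  proof (cases "r \<le> R")
    case True
    then show ?thesis using B[of r] that by auto
  next
    case False
    then show ?thesis
      using R[of r] norm_triangle_sub[of "f r" l] by (simp add: dist_norm)
  qed
  then show "\<exists>C. AE r in lebesgue. r \<in> {a<..} \<longrightarrow> norm (f r) \<le> C"
    by (intro exI[of _ "max B (norm l + 1)"]) auto
qed

section \<open>Fourier coefficients of the constant field at infinity\<close>

lemma set_integral_cis:
  fixes n :: int
  shows "set_integrable lebesgue {0..2*pi} (\<lambda>\<phi>. cis (of_int n * \<phi>))"
    and "(LINT \<phi>:{0..2*pi}|lebesgue. cis (of_int n * \<phi>)) = (if n = 0 then of_real (2 * pi) else 0)"
proof -
  show int: "set_integrable lebesgue {0..2*pi} (\<lambda>\<phi>. cis (of_int n * \<phi>))"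
    by (intro absolutely_integrable_continuous_real continuous_intros)
  have "((\<lambda>\<phi>. cis (of_int n * \<phi>)) has_integral (if n = 0 then of_real (2 * pi) else 0)) {0..2*pi}"
  proof (cases "n = 0")
    case True
    then show ?thesis
      using has_integral_const_real[of "1::complex" 0 "2 * pi"] by (simp add: scaleR_conv_of_real)
  next
    case False
    have deriv: "((\<lambda>\<phi>. exp (\<i> * of_int n * of_real \<phi>) / (\<i> * of_int n)) has_vector_derivative
        cis (of_int n * \<phi>)) (at \<phi> within {0..2*pi})" for \<phi>
    proof (rule has_vector_derivative_real_field)
      show "((\<lambda>z. exp (\<i> * of_int n * z) / (\<i> * of_int n)) has_field_derivative
          cis (of_int n * \<phi>)) (at (of_real \<phi>))"
        using False by (auto intro!: derivative_eq_intros simp: cis_conv_exp mult_ac)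
    qed
    \<comment> \<open>By periodicity the antiderivative has equal values at both endpoints, so the
      integral vanishes.\<close>
    have "exp (\<i> * of_int n * of_real (2 * pi)) = 1"
      using exp_integer_2pi[of "of_int n"] by (simp add: mult_ac)
    then show ?thesis
      using fundamental_theorem_of_calculus[OF _ deriv] False by simp
  qed
  then show "(LINT \<phi>:{0..2*pi}|lebesgue. cis (of_int n * \<phi>)) = (if n = 0 then of_real (2 * pi) else 0)"
    using set_lebesgue_integral_eq_integral(2)[OF int] by (simp add: integral_unique)
qed

text \<open>Orthogonality of the exponentials: multiplication by \<open>cis (- k \<phi>)\<close>
  shifts the frequencies to \<open>1 - k\<close> and \<open>- 1 - k\<close>, and only frequency zero
  has a nonzero mean.\<close>

lemma fourier_coeff_first_harmonics:
  "fourier_coeff (\<lambda>\<phi>. A * cis \<phi> + B * cis (- \<phi>)) k = (if k = 1 then A else 0) + (if k = - 1 then B else 0)"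
proof -
  have eq: "(A * cis \<phi> + B * cis (- \<phi>)) * cis (- (of_int k * \<phi>))
      = A * cis (of_int (1 - k) * \<phi>) + B * cis (of_int (- 1 - k) * \<phi>)" for \<phi>
    by (simp add: algebra_simps cis_mult)
  have "(LINT \<phi>:{0..2*pi}|lebesgue. (A * cis \<phi> + B * cis (- \<phi>)) * cis (- (of_int k * \<phi>)))
      = A * (LINT \<phi>:{0..2*pi}|lebesgue. cis (of_int (1 - k) * \<phi>))
        + B * (LINT \<phi>:{0..2*pi}|lebesgue. cis (of_int (- 1 - k) * \<phi>))"
    unfolding eq
    by (subst set_integral_add) (simp_all only: set_integrable_mult_right set_integral_mult_right set_integral_cis(1))
  then show ?thesis
    unfolding fourier_coeff_def set_integral_cis(2) by (auto simp: scaleR_conv_of_real)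
qed

lemma fourier_coeff_cos:
  "fourier_coeff (\<lambda>\<phi>. of_real (v * cos \<phi>)) k = kronecker_delta \<bar>k\<bar> 1 / 2 * of_real v"
proof -
  have "(\<lambda>\<phi>. complex_of_real (v * cos \<phi>)) = (\<lambda>\<phi>. of_real v / 2 * cis \<phi> + of_real v / 2 * cis (- \<phi>))"
    by (auto simp: complex_eq_iff)
  then show ?thesis
    by (simp only: fourier_coeff_first_harmonics) (auto simp: kronecker_delta_def abs_if)
qed

text \<open>By Euler's formula \<open>- sin \<phi>\<close> is \<open>\<i> / 2\<close> times
  \<open>cis \<phi> - cis (- \<phi>)\<close>, and
  \<open>\<i> / 2 = - 1 / (2 * \<i>)\<close>.\<close>

lemma fourier_coeff_minus_sin:
  "fourier_coeff (\<lambda>\<phi>. of_real (- v * sin \<phi>)) k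
    = - (of_int (sgn k) * (kronecker_delta \<bar>k\<bar> 1 / (2 * \<i>)) * of_real v)"
proof -
  have "(\<lambda>\<phi>. complex_of_real (- v * sin \<phi>))
      = (\<lambda>\<phi>. \<i> / 2 * of_real v * cis \<phi> + - (\<i> / 2 * of_real v) * cis (- \<phi>))"
    by (auto simp: complex_eq_iff)
  then show ?thesis
    by (simp only: fourier_coeff_first_harmonics) (auto simp: kronecker_delta_def abs_if divide_simps)
qed

section \<open>Uniqueness: the homogeneous system with zero boundary data\<close>

lemma divergence_eq_zeroD:
  assumes "divergence_eq_zero r0 vr vphi" "r0 > 0"
  shows "AE r in lebesgue. r0 < r \<longrightarrow>
    ((\<lambda>s. of_real s * vr k s) has_vector_derivative - \<i> * of_int k * vphi k r) (at r)"
  using assms(1)[unfolded divergence_eq_zero_def, rule_format, of k]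
proof eventually_elim
  case (elim r)
  show ?case
  proof
    assume r: "r0 < r"
    then obtain d where d: "((\<lambda>s. of_real s * vr k s) has_vector_derivative d) (at r)"
      "1 / of_real r * d + \<i> * of_int k / of_real r * vphi k r = 0"
      using elim by blast
    have "complex_of_real r \<noteq> 0" using r assms(2) by simp
    then have "d = - \<i> * of_int k * vphi k r"
      using d(2) by (simp add: field_simps add_eq_0_iff)
    then show "((\<lambda>s. of_real s * vr k s) has_vector_derivative - \<i> * of_int k * vphi k r) (at r)"
      using d(1) by simp
  qed
qed

lemma curl_eqD:
  assumes "curl_eq r0 vr vphi w" "r0 > 0"
  shows "AE r in lebesgue. r0 < r \<longrightarrow>
    ((\<lambda>s. of_real s * vphi k s) has_vector_derivative
      of_real r * w k r + \<i> * of_int k * vr k r) (at r)"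
  using assms(1)[unfolded curl_eq_def, rule_format, of k]
proof eventually_elim
  case (elim r)
  show ?case
  proof
    assume r: "r0 < r"
    then obtain d where d: "((\<lambda>s. of_real s * vphi k s) has_vector_derivative d) (at r)"
      "1 / of_real r * d - \<i> * of_int k / of_real r * vr k r = w k r"
      using elim by blast
    have "complex_of_real r \<noteq> 0" using r assms(2) by simp
    then have "d = of_real r * w k r + \<i> * of_int k * vr k r"
      using d(2) by (simp add: field_simps)
    then show "((\<lambda>s. of_real s * vphi k s) has_vector_derivative
        of_real r * w k r + \<i> * of_int k * vr k r) (at r)"
      using d(1) by simp
  qed
qed

lemma div_curl_solution_unique:
  assumes u: "div_curl_solution r0 vinf w ur uphi" and v: "div_curl_solution r0 vinf w vr vphi"
    and "r0 > 0" "r0 \<le> r"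
  shows "ur k r = vr k r \<and> uphi k r = vphi k r"
proof -
  define x where "x s = ur k s - vr k s" for s
  define y where "y s = uphi k s - vphi k s" for s
  have ac: "absolutely_continuous_on_interval r0 r x" "absolutely_continuous_on_interval r0 r y"
    using u v unfolding x_def y_def div_curl_solution_def by (auto intro: AC_diff)
  have zero: "x r0 = 0" "y r0 = 0"
    using u v by (auto simp: x_def y_def div_curl_solution_def)
  have U: "divergence_eq_zero r0 ur uphi" "curl_eq r0 ur uphi w"
    and V: "divergence_eq_zero r0 vr vphi" "curl_eq r0 vr vphi w"
    using u v by (simp_all only: div_curl_solution_def)
  have dx: "AE s in lebesgue. r0 < s \<longrightarrow>
      ((\<lambda>s. of_real s * x s) has_vector_derivative - \<i> * of_int k * y s) (at s)"
    using divergence_eq_zeroD[OF U(1) \<open>r0 > 0\<close>, of k] divergence_eq_zeroD[OF V(1) \<open>r0 > 0\<close>, of k]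
  proof eventually_elim
    case (elim s)
    show ?case
    proof
      assume s: "r0 < s"
      from has_vector_derivative_diff[OF elim(1)[rule_format, OF s] elim(2)[rule_format, OF s]]
      show "((\<lambda>s. of_real s * x s) has_vector_derivative - \<i> * of_int k * y s) (at s)" by (simp add: x_def y_def algebra_simps)
    qed
  qed
  have dy: "AE s in lebesgue. r0 < s \<longrightarrow>
      ((\<lambda>s. of_real s * y s) has_vector_derivative \<i> * of_int k * x s) (at s)"
    using curl_eqD[OF U(2) \<open>r0 > 0\<close>, of k] curl_eqD[OF V(2) \<open>r0 > 0\<close>, of k]
  proof eventually_elim
    case (elim s)
    show ?case
    proof
      assume s: "r0 < s"
      from has_vector_derivative_diff[OF elim(1)[rule_format, OF s] elim(2)[rule_format, OF s]]
      show "((\<lambda>s. of_real s * y s) has_vector_derivative \<i> * of_int k * x s) (at s)" by (simp add: x_def y_def algebra_simps)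
    qed
  qed
  \<comment> \<open>The combinations \<open>x \<plusminus> \<i> y\<close> diagonalise the homogeneous system: \<open>r powi (\<plusminus>k) * (r * (x \<plusminus> \<i> y))\<close> is constant.\<close>
  have combination: "x r + c * y r = 0" if c: "c = \<i> * of_int t" "t = 1 \<or> t = - 1" for c :: complex and t :: int
  proof -
    define E where "E s = of_real s powi (t * k) * (of_real s * x s + c * (of_real s * y s))" for s
    have "absolutely_continuous_on_interval r0 r E"
      unfolding E_def by (intro AC_mult AC_add AC_const AC_of_real AC_powi ac \<open>r0 > 0\<close>)
    moreover have "AE s in lebesgue. r0 < s \<and> s < r \<longrightarrow> (E has_vector_derivative 0) (at s)"
      using dx dy
    proof eventually_elim
      case (elim s)
      show ?case
      proof
        assume s: "r0 < s \<and> s < r"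
        let ?p = "complex_of_real s powi (t * k - 1)"
        have p: "complex_of_real s powi (t * k) = of_real s * ?p"
          using s \<open>r0 > 0\<close> by (intro powi_eq_mult_powi) simp
        have "(E has_vector_derivative
            of_real s powi (t * k) * (- \<i> * of_int k * y s + c * (\<i> * of_int k * x s))
            + of_int (t * k) * ?p * (of_real s * x s + c * (of_real s * y s))) (at s)"
          unfolding E_def using elim s \<open>r0 > 0\<close>
          by (intro has_vector_derivative_mult has_vector_derivative_powi has_vector_derivative_add
              has_vector_derivative_mult_right) auto
        \<comment> \<open>As \<open>c * \<i> = - t\<close> and \<open>t * c = \<i>\<close>, the
          terms in \<open>x s\<close> and those in \<open>y s\<close> cancel separately.\<close>
        moreover have "of_real s powi (t * k) * (- \<i> * of_int k * y s + c * (\<i> * of_int k * x s))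
            + of_int (t * k) * ?p * (of_real s * x s + c * (of_real s * y s)) = 0"
          unfolding p using c by (auto simp: algebra_simps)
        ultimately show "(E has_vector_derivative 0) (at s)" by simp
      qed
    qed
    ultimately have "E r = E r0"
      using \<open>r0 \<le> r\<close> by (intro AC_derivative_zero_imp_eq)
    then have "of_real r powi (t * k) * of_real r * (x r + c * y r) = 0"
      by (simp add: E_def zero algebra_simps)
    then show ?thesis
      using \<open>r0 > 0\<close> \<open>r0 \<le> r\<close> by simp
  qed
  \<comment> \<open>\<open>x\<close> and \<open>y\<close> are complex-valued, so both signs are
    used: \<open>x + \<i> y = 0\<close> and \<open>x - \<i> y = 0\<close> together give
    \<open>x = y = 0\<close>.\<close>
  from combination[of "\<i>" 1] combination[of "- \<i>" "- 1"] show ?thesis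
    by (simp add: x_def y_def complex_eq_iff)
qed

section \<open>Existence: assembling the solution from the two modes\<close>

definition radial_mode :: "real \<Rightarrow> real \<Rightarrow> fourier_field \<Rightarrow> fourier_field" where
  "radial_mode r0 vinf w k r =
     of_int (sgn k) * (\<i> / 2) * (inner_mode r0 \<bar>k\<bar> (w k) r + outer_mode \<bar>k\<bar> (w k) r)
     + kronecker_delta \<bar>k\<bar> 1 / 2 * of_real vinf"

definition tangential_mode :: "real \<Rightarrow> real \<Rightarrow> fourier_field \<Rightarrow> fourier_field" where
  "tangential_mode r0 vinf w k r =
     1 / 2 * (inner_mode r0 \<bar>k\<bar> (w k) r - outer_mode \<bar>k\<bar> (w k) r)
     + - (of_int (sgn k) * (kronecker_delta \<bar>k\<bar> 1 / (2 * \<i>)) * of_real vinf)"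

text \<open>The divergence equation in abstract letters: \<open>\<sigma>\<close> is
  \<open>sgn k\<close>, \<open>M\<close> is \<open>\<bar>k\<bar>\<close>, \<open>K\<close> is
  \<open>k\<close>, \<open>D\<close> the Kronecker delta, \<open>W\<close> is \<open>r * w\<close>,
  and the final factor 1 is the derivative of \<open>r\<close>. The two \<open>W\<close> cancel, and
  the constant field matches because \<open>D\<close> vanishes unless
  \<open>\<bar>k\<bar> = 1\<close>.\<close>

lemma radial_identity:
  fixes \<sigma> M K D P Q v W :: complex
  assumes "\<sigma> * M = K" "K * D = \<sigma> * D" "\<sigma> * \<sigma> * D = D"
  shows "\<sigma> * (\<i> / 2) * ((W - M * P) + (M * Q - W)) + D / 2 * v * 1
    = - (\<i> * K * (1 / 2 * (P - Q) + - (\<sigma> * (D / (2 * \<i>)) * v)))"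
proof -
  have "\<sigma> * (\<i> / 2) * ((W - M * P) + (M * Q - W)) + D / 2 * v * 1
      = \<i> / 2 * (\<sigma> * M) * (Q - P) + D * v / 2"
    by (simp add: field_simps)
  moreover have "- (\<i> * K * (1 / 2 * (P - Q) + - (\<sigma> * (D / (2 * \<i>)) * v)))
      = \<i> / 2 * K * (Q - P) + \<sigma> * (K * D) * v / 2"
    by (simp add: field_simps)
  moreover have "\<sigma> * (K * D) = D"
    using assms by (simp only: mult.assoc)
  ultimately show ?thesis by (simp only: assms(1))
qed

text \<open>The curl equation in the same letters. Here the two halves of \<open>W\<close> add up to
  the vorticity term, and \<open>K * \<sigma> = M\<close> matches the modes.\<close>

lemma tangential_identity:
  fixes \<sigma> M K D P Q v W :: complex
  assumes "K * \<sigma> = M" "K * D = \<sigma> * D"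
  shows "1 / 2 * ((W - M * P) - (M * Q - W)) + - (\<sigma> * (D / (2 * \<i>)) * v) * 1
    = W + \<i> * K * (\<sigma> * (\<i> / 2) * (P + Q) + D / 2 * v)"
proof -
  have "\<i> * K * (\<sigma> * (\<i> / 2) * (P + Q) + D / 2 * v) = - (K * \<sigma>) * (P + Q) / 2 + \<i> * (K * D) * v / 2"
    by (simp add: field_simps)
  then have eq: "\<i> * K * (\<sigma> * (\<i> / 2) * (P + Q) + D / 2 * v) = - M * (P + Q) / 2 + \<i> * (\<sigma> * D) * v / 2"
    unfolding assms .
  show ?thesis
    unfolding eq by (simp add: field_simps)
qed

text \<open>At \<open>r0\<close> the inner mode is 0 and the outer mode is
  \<open>\<i> * v * D * \<sigma>\<close>; by \<open>\<i> * \<i> = - 1\<close> it cancels the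
  constant field.\<close>

lemma boundary_identity:
  fixes \<sigma> D v :: complex
  assumes "\<sigma> * \<sigma> * D = D"
  shows "\<sigma> * (\<i> / 2) * (0 + \<i> * v * D * \<sigma>) + D / 2 * v = 0"
proof -
  have "\<sigma> * (\<i> / 2) * (0 + \<i> * v * D * \<sigma>) = - (\<sigma> * \<sigma> * D) * v / 2"
    by (simp add: field_simps)
  then show ?thesis unfolding assms by simp
qed

lemma div_curl_solution_modes:
  assumes r0: "r0 > 0"
    and w_integrable: "\<And>k. k \<noteq> 0 \<Longrightarrow> set_integrable lebesgue {r0<..} (\<lambda>s. w k s * of_real (sqrt s))"
    and w0_integrable: "set_integrable lebesgue {r0<..} (\<lambda>s. w 0 s * of_real s)"
    and moments: "\<And>k. (LINT s:{r0<..}|lebesgue. of_real s powi (- \<bar>k\<bar> + 1) * w k s) =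
        \<i> * of_real vinf * kronecker_delta \<bar>k\<bar> 1 * of_int (sgn k) / of_real r0 powi (\<bar>k\<bar> - 1)"
  shows "div_curl_solution r0 vinf w (radial_mode r0 vinf w) (tangential_mode r0 vinf w)"
proof -
  \<comment> \<open>The exponent of the integrability weight, hence also the decay rate of the modes.\<close>
  define \<alpha> :: "int \<Rightarrow> real" where "\<alpha> k = (if k = 0 then 1 else 1 / 2)" for k
  have \<alpha>: "0 < \<alpha> k" "\<alpha> k \<le> of_int \<bar>k\<bar> + 1" "1 - of_int \<bar>k\<bar> \<le> \<alpha> k" for k
    unfolding \<alpha>_def by auto
  have w: "set_integrable lebesgue {r0<..} (\<lambda>s. w k s * of_real (s powr \<alpha> k))" for k
  proof (cases "k = 0")
    case True
    have "set_integrable lebesgue {r0<..} (\<lambda>s. w 0 s * of_real (s powr 1))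
        = set_integrable lebesgue {r0<..} (\<lambda>s. w 0 s * of_real s)"
      by (rule set_integrable_cong) (use r0 in auto)
    then show ?thesis
      using w0_integrable True by (simp only: \<alpha>_def if_True simp_thms)
  next
    case False
    have "set_integrable lebesgue {r0<..} (\<lambda>s. w k s * of_real (s powr (1 / 2)))
        = set_integrable lebesgue {r0<..} (\<lambda>s. w k s * of_real (sqrt s))"
      by (rule set_integrable_cong) (use r0 in \<open>auto simp: powr_half_sqrt\<close>)
    then show ?thesis
      using w_integrable[OF False] False by (simp only: \<alpha>_def if_False)
  qed
  note mode = r0 \<alpha> w
  \<comment> \<open>The last two facts hold because the Kronecker delta leaves only
    \<open>k = 1\<close> and \<open>k = - 1\<close>, where \<open>k = sgn k\<close> has square
    1.\<close>
  have sgn: "of_int (sgn k) * of_int \<bar>k\<bar> = (of_int k :: complex)"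
    "of_int k * of_int (sgn k) = (of_int \<bar>k\<bar> :: complex)"
    "of_int k * kronecker_delta \<bar>k\<bar> 1 = of_int (sgn k) * kronecker_delta \<bar>k\<bar> 1"
    "of_int (sgn k) * of_int (sgn k) * kronecker_delta \<bar>k\<bar> 1 = kronecker_delta \<bar>k\<bar> 1" for k
    by (auto simp: sgn_if kronecker_delta_def abs_if)
  have id: "(complex_of_real has_vector_derivative 1) (at r)" for r
    using has_vector_derivative_real_field[of "\<lambda>z. z" 1 r] by simp
  have ac: "absolutely_continuous_on_interval r0 R (radial_mode r0 vinf w k)"
    "absolutely_continuous_on_interval r0 R (tangential_mode r0 vinf w k)" for k R
    unfolding radial_mode_def[abs_def] tangential_mode_def[abs_def]
    by (intro AC_add AC_diff AC_mult AC_const AC_inner_mode[OF mode] AC_outer_mode[OF mode])+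
  have div: "divergence_eq_zero r0 (radial_mode r0 vinf w) (tangential_mode r0 vinf w)"
    unfolding divergence_eq_zero_def
  proof
    fix k
    show "AE r in lebesgue. r > r0 \<longrightarrow>
        (\<exists>d. ((\<lambda>s. of_real s * radial_mode r0 vinf w k s) has_vector_derivative d) (at r) \<and>
             1 / of_real r * d + \<i> * of_int k / of_real r * tangential_mode r0 vinf w k r = 0)"
      using inner_mode_derivative[OF mode, of k] outer_mode_derivative[OF mode, of k]
    proof eventually_elim
      case (elim r)
      show ?case
      proof
        assume r: "r > r0"
        let ?P = "inner_mode r0 \<bar>k\<bar> (w k)" and ?Q = "outer_mode \<bar>k\<bar> (w k)"
        let ?d = "of_int (sgn k) * (\<i> / 2) * ((of_real r * w k r - of_int \<bar>k\<bar> * ?P r)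
              + (of_int \<bar>k\<bar> * ?Q r - of_real r * w k r))
            + kronecker_delta \<bar>k\<bar> 1 / 2 * of_real vinf * 1"
        have "((\<lambda>s. of_int (sgn k) * (\<i> / 2) * (of_real s * ?P s + of_real s * ?Q s)
            + kronecker_delta \<bar>k\<bar> 1 / 2 * of_real vinf * of_real s) has_vector_derivative ?d) (at r)"
          using elim r
          by (intro has_vector_derivative_add has_vector_derivative_mult_right id) auto
        also have "(\<lambda>s. of_int (sgn k) * (\<i> / 2) * (of_real s * ?P s + of_real s * ?Q s)
            + kronecker_delta \<bar>k\<bar> 1 / 2 * of_real vinf * of_real s)
            = (\<lambda>s. of_real s * radial_mode r0 vinf w k s)"
          by (simp add: fun_eq_iff radial_mode_def algebra_simps)
        finally have "((\<lambda>s. of_real s * radial_mode r0 vinf w k s) has_vector_derivative ?d) (at r)" .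
        moreover have "?d = - (\<i> * of_int k * tangential_mode r0 vinf w k r)"
          unfolding tangential_mode_def by (rule radial_identity) (fact sgn)+
        then have "1 / of_real r * ?d + \<i> * of_int k / of_real r * tangential_mode r0 vinf w k r = 0"
          by simp
        ultimately show "\<exists>d. ((\<lambda>s. of_real s * radial_mode r0 vinf w k s) has_vector_derivative d) (at r) \<and>
            1 / of_real r * d + \<i> * of_int k / of_real r * tangential_mode r0 vinf w k r = 0"
          by blast
      qed
    qed
  qed
  have curl: "curl_eq r0 (radial_mode r0 vinf w) (tangential_mode r0 vinf w) w"
    unfolding curl_eq_def
  proof
    fix k
    show "AE r in lebesgue. r > r0 \<longrightarrow>
        (\<exists>d. ((\<lambda>s. of_real s * tangential_mode r0 vinf w k s) has_vector_derivative d) (at r) \<and>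
             1 / of_real r * d - \<i> * of_int k / of_real r * radial_mode r0 vinf w k r = w k r)"
      using inner_mode_derivative[OF mode, of k] outer_mode_derivative[OF mode, of k]
    proof eventually_elim
      case (elim r)
      show ?case
      proof
        assume r: "r > r0"
        let ?P = "inner_mode r0 \<bar>k\<bar> (w k)" and ?Q = "outer_mode \<bar>k\<bar> (w k)"
        let ?c = "- (of_int (sgn k) * (kronecker_delta \<bar>k\<bar> 1 / (2 * \<i>)) * of_real vinf)"
        let ?d = "1 / 2 * ((of_real r * w k r - of_int \<bar>k\<bar> * ?P r)
              - (of_int \<bar>k\<bar> * ?Q r - of_real r * w k r)) + ?c * 1"
        have "((\<lambda>s. 1 / 2 * (of_real s * ?P s - of_real s * ?Q s) + ?c * of_real s)
            has_vector_derivative ?d) (at r)"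
          using elim r
          by (intro has_vector_derivative_add has_vector_derivative_diff has_vector_derivative_mult_right
              id) auto
        also have "(\<lambda>s. 1 / 2 * (of_real s * ?P s - of_real s * ?Q s) + ?c * of_real s)
            = (\<lambda>s. of_real s * tangential_mode r0 vinf w k s)"
          by (simp add: fun_eq_iff tangential_mode_def algebra_simps)
        finally have deriv: "((\<lambda>s. of_real s * tangential_mode r0 vinf w k s) has_vector_derivative ?d) (at r)" .
        have d: "?d = of_real r * w k r + \<i> * of_int k * radial_mode r0 vinf w k r"
          unfolding radial_mode_def by (rule tangential_identity) (fact sgn)+
        have "1 / of_real r * ?d - \<i> * of_int k / of_real r * radial_mode r0 vinf w k r = w k r"
          unfolding d using r r0 by (simp add: field_simps)
        with deriv show "\<exists>d. ((\<lambda>s. of_real s * tangential_mode r0 vinf w k s) has_vector_derivative d) (at r) \<and>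
            1 / of_real r * d - \<i> * of_int k / of_real r * radial_mode r0 vinf w k r = w k r"
          by blast
      qed
    qed
  qed
  have boundary: "radial_mode r0 vinf w k r0 = 0" "tangential_mode r0 vinf w k r0 = 0" for k
  proof -
    \<comment> \<open>At \<open>r0\<close> the outer integral is the full moment, whose denominator
      cancels the prefactor of the outer mode.\<close>
    have "complex_of_real r0 powi (\<bar>k\<bar> - 1) \<noteq> 0"
      using r0 by (simp add: power_int_eq_0_iff)
    then have outer: "outer_mode \<bar>k\<bar> (w k) r0
        = \<i> * of_real vinf * kronecker_delta \<bar>k\<bar> 1 * of_int (sgn k)"
      unfolding outer_mode_def moments by simp
    show "radial_mode r0 vinf w k r0 = 0"
      unfolding radial_mode_def outer inner_mode_at_boundary
      by (rule boundary_identity) (fact sgn)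
    \<comment> \<open>Since \<open>1 / \<i> = - \<i>\<close>, half of the outer mode cancels against
      the constant term.\<close>
    show "tangential_mode r0 vinf w k r0 = 0"
      unfolding tangential_mode_def outer inner_mode_at_boundary
      by (simp add: field_simps)
  qed
  have lim: "(radial_mode r0 vinf w k \<longlongrightarrow> fourier_coeff (\<lambda>\<phi>. of_real (vinf * cos \<phi>)) k) at_top"
    "(tangential_mode r0 vinf w k \<longlongrightarrow> fourier_coeff (\<lambda>\<phi>. of_real (- vinf * sin \<phi>)) k) at_top" for k
  proof -
    show "(radial_mode r0 vinf w k \<longlongrightarrow> fourier_coeff (\<lambda>\<phi>. of_real (vinf * cos \<phi>)) k) at_top"
      unfolding radial_mode_def[abs_def] fourier_coeff_cos
      by (rule tendsto_eq_intros inner_mode_tendsto_0[OF mode] outer_mode_tendsto_0[OF mode] refl)+ simp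
    show "(tangential_mode r0 vinf w k \<longlongrightarrow> fourier_coeff (\<lambda>\<phi>. of_real (- vinf * sin \<phi>)) k) at_top"
      unfolding tangential_mode_def[abs_def] fourier_coeff_minus_sin
      by (rule tendsto_eq_intros inner_mode_tendsto_0[OF mode] outer_mode_tendsto_0[OF mode] refl)+ simp
  qed
  show ?thesis
    unfolding div_curl_solution_def using ac div curl boundary lim by blast
qed

theorem theorem2p1:
  fixes r0 vinf :: real and w :: "int \<Rightarrow> real \<Rightarrow> complex"
  assumes r0_pos: "r0 > 0"
    and w_integrable: "\<And>k. k \<noteq> 0 \<Longrightarrow> set_integrable lebesgue {r0<..} (\<lambda>s. w k s * of_real (sqrt s))"
    and w0_integrable: "set_integrable lebesgue {r0<..} (\<lambda>s. w 0 s * of_real s)"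
    and moments: "\<And>k. (LINT s:{r0<..}|lebesgue. of_real s powi (- \<bar>k\<bar> + 1) * w k s) =
        \<i> * of_real vinf * kronecker_delta \<bar>k\<bar> 1 * of_int (sgn k) / of_real r0 powi (\<bar>k\<bar> - 1)"
  shows "\<exists>vr vphi.
    div_curl_solution r0 vinf w vr vphi \<and>
    (\<forall>ur uphi. div_curl_solution r0 vinf w ur uphi \<longrightarrow>
       (\<forall>k. \<forall>r\<ge>r0. ur k r = vr k r \<and> uphi k r = vphi k r)) \<and>
    (\<forall>k. \<forall>r\<ge>r0.
       vr k r =
         of_int (sgn k) * (\<i> * of_real r powi (- \<bar>k\<bar> - 1) / 2) *
           (LINT s:{r0<..<r}|lebesgue. of_real s powi (\<bar>k\<bar> + 1) * w k s) +
         of_int (sgn k) * (\<i> * of_real r powi (\<bar>k\<bar> - 1) / 2) *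
           (LINT s:{r<..}|lebesgue. of_real s powi (- \<bar>k\<bar> + 1) * w k s) +
         kronecker_delta \<bar>k\<bar> 1 / 2 * of_real vinf \<and>
       vphi k r =
         of_real r powi (- \<bar>k\<bar> - 1) / 2 *
           (LINT s:{r0<..<r}|lebesgue. of_real s powi (\<bar>k\<bar> + 1) * w k s) -
         of_real r powi (\<bar>k\<bar> - 1) / 2 *
           (LINT s:{r<..}|lebesgue. of_real s powi (- \<bar>k\<bar> + 1) * w k s) -
         of_int (sgn k) * (kronecker_delta \<bar>k\<bar> 1 / (2 * \<i>)) * of_real vinf) \<and>
    (\<forall>k. essentially_bounded_on {r0<..} (vr k) \<and> essentially_bounded_on {r0<..} (vphi k))"
proof (rule exI[of _ "radial_mode r0 vinf w"], rule exI[of _ "tangential_mode r0 vinf w"], intro conjI)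
  show sol: "div_curl_solution r0 vinf w (radial_mode r0 vinf w) (tangential_mode r0 vinf w)"
    using assms by (rule div_curl_solution_modes)
  show "\<forall>ur uphi. div_curl_solution r0 vinf w ur uphi \<longrightarrow>
      (\<forall>k. \<forall>r\<ge>r0. ur k r = radial_mode r0 vinf w k r \<and> uphi k r = tangential_mode r0 vinf w k r)"
    using div_curl_solution_unique[OF _ sol r0_pos] by blast
  show "\<forall>k. essentially_bounded_on {r0<..} (radial_mode r0 vinf w k) \<and>
      essentially_bounded_on {r0<..} (tangential_mode r0 vinf w k)"
    using sol unfolding div_curl_solution_def by (meson essentially_bounded_on_of_AC)
\<comment> \<open>The explicit formulas remain; they are the mode definitions unfolded, with the
  common factors distributed.\<close>
qed (auto simp: radial_mode_def tangential_mode_def inner_mode_def outer_mode_def field_simps)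

end
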